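(* Let $d\in\{1,\dots,n-1\}$, and consider the discrete-time load balancing system with $n$ servers, potential services $\{\boldsymbol s(k)\}$ with mean vector $\boldsymbol\mu=(\mu_1,\dots,\mu_n)\in\mathbb R_+^n$ and $\mu_\Sigma=\sum_{i=1}^n\mu_i>0$, described in the context. Define $$\mathcal M^{(d)}=\left\{\boldsymbol\mu\in\mathbb R_+^n:\ \frac{\sum_{i=1}^{j}\mu_{(i)}}{\mu_\Sigma}\ \ge\ \frac{\binom{j}{d}}{\binom{n}{d}}\quad\text{for all integers } j \text{ with } d\le j\le n-1\right\},$$ where $\mu_{(i)}$ denotes the $i$-th smallest entry of $\boldsymbol\mu$. Then the power-of-$d$ choices algorithm is throughput optimal for this load balancing system if and only if $\boldsymbol\mu\in\mathcal M^{(d)}$.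
   Context: Notation: $\mathbb R_+$, $\mathbb Z_+$ are the nonnegative reals and integers. Model. Time is slotted, $k\in\mathbb Z_+$. There are $n$ servers, each with an infinite-buffer queue; $q_i(k)\in\mathbb Z_+$ is the number of jobs in queue $i$ (including any in service) at the beginning of slot $k$, and $\boldsymbol q(k)=(q_1(k),\dots,q_n(k))$. The total number of arrivals in slot $k$ is $a(k)\in\mathbb Z_+$, where $\{a(k)\}$ is i.i.d. with mean $\lambda=\mathbb E[a(1)]$ and finite second moment. In each slot a dispatcher sends all arrivals of that slot to a single queue $i^*$, chosen by a routing algorithm, so $a_{i^*}(k)=a(k)$ and $a_i(k)=0$ for $i\ne i^*$. The potential service vectors $\boldsymbol s(k)\in\mathbb Z_+^n$ ($s_i(k)$ is the number of jobs that can be processed in queue $i$ in slot $k$ if there are enough jobs in line) are i.i.d. over $k$ (entries within a slot may be dependent), with mean $\boldsymbol\mu=\mathbb E[\boldsymbol s(1)]$ and finite second moments, and are independent of the arrivals; $\boldsymbol s(k)$ is independent of the queue lengths up to slot $k$ and of the routing decision in slot $k$. Arrivals and routing occur before service in each slot, so $$q_i(k+1)=q_i(k)+a_i(k)-s_i(k)+u_i(k),\qquad u_i(k)=\max\{s_i(k)-q_i(k)-a_i(k),0\},$$ where $u_i(k)$ is called the unused service. Then $\{\boldsymbol q(k)\}$ is a discrete-time Markov chain. Power-of-$d$ choices. In each slot, select $d$ distinct queues uniformly at random among the $n$ queues and route all arrivals of the slot to a shortest (with respect to $\boldsymbol q(k)$) of the selected queues, ties being broken at random. Capacity region and throughput optimality.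 The capacity region is $\mathcal C=\{\lambda\in\mathbb R_+:\lambda\le\mu_\Sigma\}$, and its interior is $\mathrm{Int}(\mathcal C)=(0,\mu_\Sigma)$. A routing algorithm is throughput optimal if the queue length process $\{\boldsymbol q(k):k\in\mathbb Z_+\}$ of the load balancing system operating under that algorithm is positive recurrent for all $\lambda\in\mathrm{Int}(\mathcal C)$.
   Formalization: For d ≥ 2 the direction "μ in M^(d) implies throughput optimal" is stated only when all μ_i > 0; it fails if some μ_i = 0 (e.g. n=3, d=2, s=(0,5,5), a=8: queue 1 grows without bound). The converse is unconditional, and d = 1 needs no extra assumption. *)

theory Defs
  imports "HOL-Probability.Probability"
begin

section \<open>Discrete-time load balancing systems\<close>

text \<open>
  The servers are the elements of the finite type \<open>'n\<close>, so their number is \<open>CARD('n)\<close>.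
  A routing algorithm is a pair: a law \<open>R\<close> of the randomness drawn afresh in each slot, and a map
  \<open>route\<close> taking that randomness and the current queue lengths to the queue that receives
  all arrivals of the slot.
\<close>

type_synonym ('n, 'r) slot_input = "nat \<times> ('n \<Rightarrow> nat) \<times> 'r"

definition arrivals :: "nat \<Rightarrow> 'n \<Rightarrow> 'n \<Rightarrow> nat" where
  "arrivals a i_star i = (if i = i_star then a else 0)"

text \<open>Subtraction on \<open>nat\<close> is truncated, so this is $\max\{s_i - q_i - a_i, 0\}$.\<close>

definition unused_service :: "('n \<Rightarrow> nat) \<Rightarrow> ('n \<Rightarrow> nat) \<Rightarrow> ('n \<Rightarrow> nat) \<Rightarrow> 'n \<Rightarrow> nat" where
  "unused_service q a s i = s i - (q i + a i)"

text \<open>No truncation occurs here, since \<open>s i \<le> q i + a i + unused_service q a s i\<close>.\<close>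

definition next_queue :: "('n \<Rightarrow> nat) \<Rightarrow> ('n \<Rightarrow> nat) \<Rightarrow> ('n \<Rightarrow> nat) \<Rightarrow> 'n \<Rightarrow> nat" where
  "next_queue q a s i = q i + a i + unused_service q a s i - s i"

primrec queue_process ::
  "('r \<Rightarrow> ('n \<Rightarrow> nat) \<Rightarrow> 'n) \<Rightarrow> ('n \<Rightarrow> nat) \<Rightarrow> nat \<Rightarrow> (nat \<Rightarrow> ('n, 'r) slot_input) \<Rightarrow> 'n \<Rightarrow> nat"
where
  "queue_process route q0 0 \<omega> = q0"
| "queue_process route q0 (Suc k) \<omega> =
     (case \<omega> k of (a, s, r) \<Rightarrow>
        next_queue (queue_process route q0 k \<omega>)
          (arrivals a (route r (queue_process route q0 k \<omega>))) s)"

text \<open>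
  \<open>A\<close> is the law of the number of arrivals in a slot and \<open>S\<close> the joint law of the potential
  services in a slot, whose entries may be dependent. Slots are i.i.d.; within a slot the
  arrivals, the services and the routing randomness are independent.
\<close>

definition input_space ::
  "nat pmf \<Rightarrow> ('n \<Rightarrow> nat) pmf \<Rightarrow> 'r pmf \<Rightarrow> (nat \<Rightarrow> ('n, 'r) slot_input) measure" where
  "input_space A S R = (\<Pi>\<^sub>M k\<in>UNIV. measure_pmf (pair_pmf A (pair_pmf S R)))"


section \<open>Positive recurrence\<close>

text \<open>
  \<open>X x k\<close> is the state at time \<open>k\<close> of the chain started in \<open>x\<close>, as a random variable on \<open>M\<close>.
  The infimum of the empty set is \<open>\<infinity>\<close>.
\<close>

definition return_time :: "('x \<Rightarrow> nat \<Rightarrow> 'w \<Rightarrow> 'x) \<Rightarrow> 'x \<Rightarrow> 'w \<Rightarrow> enat" where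
  "return_time X x \<omega> = Inf {enat k | k. 1 \<le> k \<and> X x k \<omega> = x}"

definition positive_recurrent_state :: "'w measure \<Rightarrow> ('x \<Rightarrow> nat \<Rightarrow> 'w \<Rightarrow> 'x) \<Rightarrow> 'x \<Rightarrow> bool" where
  "positive_recurrent_state M X x \<longleftrightarrow>
     (\<integral>\<^sup>+ \<omega>. ennreal_of_enat (return_time X x \<omega>) \<partial>M) < \<infinity>"

text \<open>
  The queue length chain need not be irreducible on all of \<open>'n \<Rightarrow> nat\<close>: with deterministic
  arrivals and services some states may never be revisited. A chain that may have transient states
  is called positive recurrent if from every initial state it almost surely enters the set of
  positive recurrent states. For an irreducible chain this is the usual notion, since then either
  all states are positive recurrent or none is.
\<close>

definition positive_recurrent :: "'w measure \<Rightarrow> ('x \<Rightarrow> nat \<Rightarrow> 'w \<Rightarrow> 'x) \<Rightarrow> bool" where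
  "positive_recurrent M X \<longleftrightarrow>
     (\<forall>x. AE \<omega> in M. \<exists>k. positive_recurrent_state M X (X x k \<omega>))"


section \<open>Throughput optimality\<close>

definition mean_service :: "('n \<Rightarrow> nat) pmf \<Rightarrow> 'n \<Rightarrow> real" where
  "mean_service S i = measure_pmf.expectation S (\<lambda>s. real (s i))"

definition capacity_region :: "('n::finite \<Rightarrow> real) \<Rightarrow> real set" where
  "capacity_region \<mu> = {l. 0 \<le> l \<and> l \<le> (\<Sum>i\<in>UNIV. \<mu> i)}"

lemma interior_capacity_region:
  "interior (capacity_region \<mu>) = {0 <..< (\<Sum>i\<in>UNIV. \<mu> i)}"
proof -
  have "capacity_region \<mu> = {0 .. (\<Sum>i\<in>UNIV. \<mu> i)}"
    by (auto simp: capacity_region_def)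
  then show ?thesis by simp
qed

text \<open>The arrival law may depend on the arrival rate: \<open>A l\<close> is the one used at rate \<open>l\<close>.\<close>

definition throughput_optimal ::
  "(real \<Rightarrow> nat pmf) \<Rightarrow> ('n::finite \<Rightarrow> nat) pmf \<Rightarrow> 'r pmf \<Rightarrow> ('r \<Rightarrow> ('n \<Rightarrow> nat) \<Rightarrow> 'n) \<Rightarrow> bool"
where
  "throughput_optimal A S R route \<longleftrightarrow>
     (\<forall>l\<in>interior (capacity_region (mean_service S)).
        positive_recurrent (input_space (A l) S R) (queue_process route))"


section \<open>Power-of-d choices\<close>

definition shortest :: "'n set \<Rightarrow> ('n \<Rightarrow> nat) \<Rightarrow> 'n set" where
  "shortest D q = {i \<in> D. \<forall>j\<in>D. q i \<le> q j}"

text \<open>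
  The randomness of a slot is a uniform set \<open>D\<close> of \<open>d\<close> servers together with a tie-breaking
  table \<open>c\<close>, where the entries \<open>c B\<close> are independent and uniform on \<open>B\<close> for nonempty \<open>B\<close>.
  Only one entry of the table is used, so a tie is broken uniformly; see \<open>power_of_d_law\<close>.
\<close>

definition power_of_d_randomness :: "nat \<Rightarrow> ('n::finite set \<times> ('n set \<Rightarrow> 'n)) pmf" where
  "power_of_d_randomness d =
     pair_pmf (pmf_of_set {D. card D = d}) (Pi_pmf (UNIV - {{}}) undefined pmf_of_set)"

definition power_of_d_route :: "'n set \<times> ('n set \<Rightarrow> 'n) \<Rightarrow> ('n \<Rightarrow> nat) \<Rightarrow> 'n" where
  "power_of_d_route r q = (case r of (D, c) \<Rightarrow> c (shortest D q))"

lemma power_of_d_law: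
  fixes q :: "'n::finite \<Rightarrow> nat"
  assumes "1 \<le> d" "d \<le> CARD('n)"
  shows "map_pmf (\<lambda>r. power_of_d_route r q) (power_of_d_randomness d) =
    bind_pmf (pmf_of_set {D. card D = d}) (\<lambda>D. pmf_of_set (shortest D q))"
proof -
  have "\<exists>D :: 'n set. card D = d"
    using assms(2) obtain_subset_with_card_n[of d "UNIV :: 'n set"] by blast
  then have ne: "{D :: 'n set. card D = d} \<noteq> {}" by auto
  have *: "map_pmf (\<lambda>c. c (shortest D q)) (Pi_pmf (UNIV - {{}}) undefined pmf_of_set)
      = pmf_of_set (shortest D q)" if "card D = d" for D :: "'n set"
  proof -
    from that assms(1) have D: "D \<noteq> {}" by auto
    then obtain i where "i \<in> D" "\<And>j. j \<in> D \<Longrightarrow> q i \<le> q j"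
      using arg_min_if_finite(1)[of D q] arg_min_least[of D _ q] by (metis finite)
    then have "shortest D q \<noteq> {}" by (auto simp: shortest_def)
    then show ?thesis by (simp add: Pi_pmf_component)
  qed
  have set: "set_pmf (pmf_of_set {D :: 'n set. card D = d}) = {D. card D = d}"
    using ne by (intro set_pmf_of_set) auto
  have "map_pmf (\<lambda>r. power_of_d_route r q) (power_of_d_randomness d) =
      bind_pmf (pmf_of_set {D. card D = d})
        (\<lambda>D. map_pmf (\<lambda>c. c (shortest D q)) (Pi_pmf (UNIV - {{}}) undefined pmf_of_set))"
    by (simp add: power_of_d_randomness_def power_of_d_route_def pair_pmf_def map_bind_pmf
        map_pmf_def bind_assoc_pmf bind_return_pmf)
  also have "\<dots> = bind_pmf (pmf_of_set {D. card D = d}) (\<lambda>D. pmf_of_set (shortest D q))"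
    by (rule bind_pmf_cong[OF refl]) (use * set in auto)
  finally show ?thesis .
qed


section \<open>The stability region\<close>

text \<open>The argument \<open>i\<close> counts from 1, and entries are repeated according to multiplicity.\<close>

definition order_stat :: "('n::finite \<Rightarrow> real) \<Rightarrow> nat \<Rightarrow> real" where
  "order_stat \<mu> i = sorted_list_of_multiset (image_mset \<mu> (mset_set UNIV)) ! (i - 1)"

text \<open>
  For \<open>2 \<le> d\<close> this set contains vectors with a zero entry. A server that is never served is not
  stable: with \<open>d = 2\<close>, services (0,5,5) and 8 arrivals in every slot, the first queue grows
  without bound although (0,5,5) lies in the set.
\<close>

definition stability_region :: "nat \<Rightarrow> ('n::finite \<Rightarrow> real) set" where
  "stability_region d =
     {\<mu>. (\<forall>i. 0 \<le> \<mu> i) \<and>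
         (\<forall>j. d \<le> j \<and> j \<le> CARD('n) - 1 \<longrightarrow>
            (\<Sum>i=1..j. order_stat \<mu> i) / (\<Sum>i\<in>UNIV. \<mu> i)
              \<ge> real (j choose d) / real (CARD('n) choose d))}"

end

theory Submission
  imports Defs
begin

text \<open>
  Sufficiency: the Lyapunov function $V(q) = \sum_i q_i^2$ has drift at most
  $2 \lambda E [\min_{i \in D} q_i] - 2 \sum_i \mu_i q_i + C$, where $D$ is the random sample. Writing $q$
  as the sum over $t$ of the indicators of its level sets $T_t = \{i. q_i > t\}$, the expected minimum is
  $\sum_t P(D \subseteq T_t)$ and $\sum_i \mu_i q_i = \sum_t \mu(T_t)$. Membership in the stability region says
  exactly that $P(D \subseteq T) \le \mu(T) / \mu_\Sigma$ for all $T$, so the drift is at most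
  $C - 2 (1 - \lambda / \mu_\Sigma) \sum_i \mu_i q_i$, and Foster's criterion applies.

  Necessity: let $J$ consist of the $j$ slowest servers. All arrivals go to $J$ whenever $D \subseteq J$, so over a
  cycle between two visits to a positive recurrent state at least $\lambda P(D \subseteq J)$ jobs per slot
  arrive in $J$ on average, and at most $\mu(J)$ leave. Hence $\lambda P(D \subseteq J) \le \mu(J)$ for all
  $\lambda < \mu_\Sigma$.
\<close>

section \<open>Random recursions\<close>

locale random_recursion =
  fixes f :: "'x::countable \<Rightarrow> 'i \<Rightarrow> 'x" and I :: "'i pmf"
begin

sublocale sequence_space "measure_pmf I"
  by unfold_locales

primrec orbit :: "'x \<Rightarrow> nat \<Rightarrow> (nat \<Rightarrow> 'i) \<Rightarrow> 'x" where
  "orbit x 0 \<omega> = x"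
| "orbit x (Suc k) \<omega> = f (orbit x k \<omega>) (\<omega> k)"

lemma orbit_case_nat: "orbit x (Suc k) (case_nat i \<omega>) = orbit (f x i) k \<omega>"
  by (induction k) auto

lemma measurable_orbit [measurable]: "orbit x k \<in> S \<rightarrow>\<^sub>M count_space UNIV"
proof (induction k)
  case 0
  then show ?case by (simp add: orbit.simps(1)[abs_def])
next
  case (Suc k)
  have "(\<lambda>\<omega>. f (orbit x k \<omega>) (\<omega> k)) \<in> S \<rightarrow>\<^sub>M count_space UNIV"
  proof (rule measurable_compose_countable[OF _ Suc])
    fix y
    have "(\<lambda>\<omega>. \<omega> k) \<in> S \<rightarrow>\<^sub>M measure_pmf I" by measurable
    moreover have "f y \<in> measure_pmf I \<rightarrow>\<^sub>M count_space UNIV" by simp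
    ultimately show "(\<lambda>\<omega>. f y (\<omega> k)) \<in> S \<rightarrow>\<^sub>M count_space UNIV"
      by (rule measurable_compose)
  qed
  then show ?case by simp
qed

section \<open>Avoidance probabilities and hitting times\<close>

definition avoids :: "'x set \<Rightarrow> nat \<Rightarrow> 'x \<Rightarrow> (nat \<Rightarrow> 'i) \<Rightarrow> bool" where
  "avoids G k x \<omega> \<longleftrightarrow> (\<forall>j<k. orbit x (Suc j) \<omega> \<notin> G)"

text \<open>The probability that the first visit to \<open>G\<close> at a time \<ge> 1 comes after
  time \<open>k\<close>. Time 0 does not count, so \<open>G = {x}\<close> gives the tail of the
  return time of \<open>x\<close>.\<close>

definition avoid_prob :: "'x set \<Rightarrow> nat \<Rightarrow> 'x \<Rightarrow> ennreal" where
  "avoid_prob G k x = (\<integral>\<^sup>+\<omega>. indicator {\<omega>. avoids G k x \<omega>} \<omega> \<partial>S)"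

lemma avoids_0 [simp]: "avoids G 0 x \<omega>"
  by (simp add: avoids_def)

lemma avoids_case_nat:
  "avoids G (Suc k) x (case_nat i \<omega>) \<longleftrightarrow> f x i \<notin> G \<and> avoids G k (f x i) \<omega>"
  unfolding avoids_def orbit_case_nat All_less_Suc2 by simp

lemma measurable_avoids [measurable]: "Measurable.pred S (avoids G k x)"
proof -
  have [measurable]: "Measurable.pred S (\<lambda>\<omega>. orbit x j \<omega> \<notin> G)" for j
    by (rule measurable_compose[OF measurable_orbit]) simp
  show ?thesis unfolding avoids_def by measurable
qed

text \<open>An i.i.d. sequence keeps its law when an independent draw is put in front of it, so the
  first input can be integrated out separately. Together with \<open>orbit_case_nat\<close> this is
  the Markov property at time 1.\<close>

lemma nn_integral_first_step:
  assumes [measurable]: "g \<in> borel_measurable S"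
  shows "(\<integral>\<^sup>+\<omega>. g \<omega> \<partial>S) = (\<integral>\<^sup>+i. \<integral>\<^sup>+\<omega>. g (case_nat i \<omega>) \<partial>S \<partial>measure_pmf I)"
proof -
  have "(\<integral>\<^sup>+\<omega>. g \<omega> \<partial>S) =
      (\<integral>\<^sup>+z. g (case z of (i, \<omega>) \<Rightarrow> case_nat i \<omega>) \<partial>(measure_pmf I \<Otimes>\<^sub>M S))"
    by (subst PiM_iter[symmetric]) (simp add: nn_integral_distr)
  also have "\<dots> = (\<integral>\<^sup>+i. \<integral>\<^sup>+\<omega>. g (case_nat i \<omega>) \<partial>S \<partial>measure_pmf I)"
    by (subst nn_integral_fst[symmetric]) auto
  finally show ?thesis .
qed

lemma measurable_coordinate [measurable]: "(\<lambda>\<omega>. \<phi> (\<omega> k) :: ennreal) \<in> borel_measurable S"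
proof -
  have "(\<lambda>\<omega>. \<omega> k) \<in> S \<rightarrow>\<^sub>M measure_pmf I" by measurable
  then show ?thesis by (rule measurable_compose) simp
qed

lemma avoid_prob_0 [simp]: "avoid_prob G 0 x = 1"
  by (simp add: avoid_prob_def emeasure_space_1)

text \<open>\<open>\<omega> k\<close> is independent of the path up to time \<open>k\<close>.\<close>

lemma nn_integral_avoids:
  "(\<integral>\<^sup>+\<omega>. \<phi> (\<omega> k) * indicator {\<omega>. avoids G k x \<omega>} \<omega> \<partial>S) =
    (\<integral>\<^sup>+i. \<phi> i \<partial>measure_pmf I) * avoid_prob G k x" (is "?lhs k x = ?c * _")
  and avoid_prob_Suc:
  "avoid_prob G (Suc k) x =
    (\<integral>\<^sup>+i. indicator (- G) (f x i) * avoid_prob G k (f x i) \<partial>measure_pmf I)"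
proof -
  \<comment> \<open>Conditioning on the first input turns coordinate \<open>Suc k\<close> into
    coordinate \<open>k\<close> of the remaining sequence. The constant \<psi> = 1 yields the
    recursion for \<open>avoid_prob\<close>; general \<psi> drives the induction for the product
    formula.\<close>
  have step: "(\<integral>\<^sup>+\<omega>. \<psi> (\<omega> (Suc k)) * indicator {\<omega>. avoids G (Suc k) x \<omega>} \<omega> \<partial>S) =
      (\<integral>\<^sup>+i. indicator (- G) (f x i) *
        (\<integral>\<^sup>+\<omega>. \<psi> (\<omega> k) * indicator {\<omega>. avoids G k (f x i) \<omega>} \<omega> \<partial>S) \<partial>measure_pmf I)"
    for \<psi> :: "'i \<Rightarrow> ennreal" and k x
    apply (subst nn_integral_first_step)
     apply measurable
    apply (subst nn_integral_cmult[symmetric])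
     apply measurable
    apply (intro nn_integral_cong)
    apply (auto simp: indicator_def avoids_case_nat)
    done
  show avoid_Suc: "avoid_prob G (Suc k) x =
    (\<integral>\<^sup>+i. indicator (- G) (f x i) * avoid_prob G k (f x i) \<partial>measure_pmf I)" for k x
    using step[of "\<lambda>_. 1"] by (simp add: avoid_prob_def)
  show "?lhs k x = ?c * avoid_prob G k x"
  proof (induction k arbitrary: x)
    case 0
    show ?case
      by (subst nn_integral_first_step) (auto simp: emeasure_space_1)
  next
    case (Suc k)
    show ?case
      unfolding step Suc.IH avoid_Suc
      by (subst nn_integral_cmult[symmetric]) (auto simp: ac_simps)
  qed
qed

lemma avoid_prob_Suc_le: "avoid_prob G (Suc k) x \<le> avoid_prob G k x"
  unfolding avoid_prob_def
  by (intro nn_integral_mono) (auto simp: indicator_def avoids_def)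

lemma avoid_prob_antimono: "k \<le> l \<Longrightarrow> avoid_prob G l x \<le> avoid_prob G k x"
  using lift_Suc_antimono_le[of "\<lambda>k. avoid_prob G k x"] avoid_prob_Suc_le by blast

lemma avoid_prob_le_1: "avoid_prob G k x \<le> 1"
  using avoid_prob_antimono[of 0 k] by simp

text \<open>Replaces the infimum in \<open>enat\<close> by an attained natural number
  \<open>n\<close>, so that on such a path the avoidance events are just the conditions
  \<open>k < n\<close>.\<close>

lemma avoids_hit:
  assumes "\<exists>k\<ge>1. orbit x k \<omega> \<in> G"
  shows "\<exists>n. Inf {enat k | k. 1 \<le> k \<and> orbit x k \<omega> \<in> G} = enat n \<and>
    orbit x n \<omega> \<in> G \<and> (\<forall>k. avoids G k x \<omega> \<longleftrightarrow> k < n)"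
proof -
  define n where "n = (LEAST k. 1 \<le> k \<and> orbit x k \<omega> \<in> G)"
  have n: "1 \<le> n" "orbit x n \<omega> \<in> G"
    using LeastI_ex[OF assms] by (auto simp: n_def)
  have least: "n \<le> k" if "1 \<le> k" "orbit x k \<omega> \<in> G" for k
    using that unfolding n_def by (intro Least_le) auto
  show ?thesis
  proof (intro exI conjI allI)
    show "Inf {enat k | k. 1 \<le> k \<and> orbit x k \<omega> \<in> G} = enat n"
      by (intro antisym Inf_lower Inf_greatest) (use n least in auto)
    show "orbit x n \<omega> \<in> G" by fact
    show "avoids G k x \<omega> \<longleftrightarrow> k < n" for k
    proof
      assume avoids: "avoids G k x \<omega>"
      show "k < n"
      proof (rule ccontr)
        assume "\<not> k < n"
        then have "n - 1 < k" using n by simp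
        then have "orbit x (Suc (n - 1)) \<omega> \<notin> G" using avoids unfolding avoids_def by blast
        then show False using n by simp
      qed
    next
      assume "k < n"
      then show "avoids G k x \<omega>" unfolding avoids_def
        using least by (metis One_nat_def Suc_le_eq Suc_leI le_add1 not_less plus_1_eq_Suc le_trans)
    qed
  qed
qed

lemma avoid_prob_finite [simp]: "avoid_prob G k x \<noteq> \<top>"
  using avoid_prob_le_1[of G k x] by (auto simp: top_unique)

text \<open>Tail-sum formula on a single path: a hitting time is the number of \<open>k\<close> that
  it exceeds, and it is infinite if \<open>G\<close> is never hit.\<close>

lemma suminf_avoids:
  "(\<Sum>k. indicator {\<omega>. avoids G k x \<omega>} \<omega> :: ennreal) =
    ennreal_of_enat (Inf {enat k | k. 1 \<le> k \<and> orbit x k \<omega> \<in> G})"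
proof (cases "\<exists>k\<ge>1. orbit x k \<omega> \<in> G")
  case True
  then obtain n where n: "Inf {enat k | k. 1 \<le> k \<and> orbit x k \<omega> \<in> G} = enat n"
    "\<forall>k. avoids G k x \<omega> \<longleftrightarrow> k < n"
    using avoids_hit by blast
  have "(\<Sum>k. indicator {\<omega>. avoids G k x \<omega>} \<omega> :: ennreal) = of_nat n"
    by (subst suminf_finite[of "{..<n}"]) (auto simp: n(2))
  with n show ?thesis by simp
next
  case False
  then have "avoids G k x \<omega>" for k by (auto simp: avoids_def)
  moreover have "(\<Sum>k. 1 :: ennreal) = \<infinity>"
  proof (rule ccontr)
    assume "(\<Sum>k. 1 :: ennreal) \<noteq> \<infinity>"
    then obtain n where "(\<Sum>k. 1 :: ennreal) < of_nat n"
      using ennreal_Ex_less_of_nat by (auto simp: less_top)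
    moreover have "of_nat n \<le> (\<Sum>k. 1 :: ennreal)"
      using sum_le_suminf[of "\<lambda>_. 1 :: ennreal" "{..<n}"] by simp
    ultimately show False by simp
  qed
  moreover have none: "{enat k | k. 1 \<le> k \<and> orbit x k \<omega> \<in> G} = {}"
    using False by auto
  ultimately show ?thesis unfolding none by (simp add: top_enat_def)
qed

lemma nn_integral_suminf_avoids:
  "(\<integral>\<^sup>+\<omega>. (\<Sum>k. indicator {\<omega>. avoids G k x \<omega>} \<omega>) \<partial>S) = (\<Sum>k. avoid_prob G k x)"
  unfolding avoid_prob_def by (rule nn_integral_suminf) measurable

section \<open>Return times and the balance over a cycle\<close>

lemma return_time_eq:
  "ennreal_of_enat (return_time orbit x \<omega>) = (\<Sum>k. indicator {\<omega>. avoids {x} k x \<omega>} \<omega>)"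
  by (simp add: suminf_avoids return_time_def)

text \<open>The tail-sum formula integrated term by term. This is the form in which positive
  recurrence is used and proved.\<close>

lemma positive_recurrent_state_iff:
  "positive_recurrent_state S orbit x \<longleftrightarrow> (\<Sum>k. avoid_prob {x} k x) < \<infinity>"
  unfolding positive_recurrent_state_def return_time_eq nn_integral_suminf_avoids ..

text \<open>
  Summed up to the return time, \<open>L\<close> cancels in the hypothesis. By Wald's identity the remaining
  sums of \<open>\<alpha>\<close> and \<open>\<beta>\<close> have expectation mean times expected return time, which is finite.
\<close>

lemma positive_recurrent_balance:
  fixes L :: "'x \<Rightarrow> nat" and \<alpha> \<beta> :: "'i \<Rightarrow> nat"
  assumes step: "\<And>x i. i \<in> set_pmf I \<Longrightarrow> L x + \<alpha> i \<le> L (f x i) + \<beta> i"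
    and rec: "positive_recurrent_state S orbit x"
  shows "(\<integral>\<^sup>+i. of_nat (\<alpha> i) \<partial>measure_pmf I) \<le> (\<integral>\<^sup>+i. of_nat (\<beta> i) \<partial>measure_pmf I)"
proof -
  let ?T = "\<Sum>k. avoid_prob {x} k x"
  have wald: "(\<integral>\<^sup>+\<omega>. (\<Sum>k. \<phi> (\<omega> k) * indicator {\<omega>. avoids {x} k x \<omega>} \<omega>) \<partial>S) =
      (\<integral>\<^sup>+i. \<phi> i \<partial>measure_pmf I) * ?T" for \<phi> :: "'i \<Rightarrow> ennreal"
    by (subst nn_integral_suminf) (auto simp: nn_integral_avoids)
  have T: "?T < \<infinity>" using rec by (simp add: positive_recurrent_state_iff)
  have "AE \<omega> in S. ennreal_of_enat (return_time orbit x \<omega>) \<noteq> \<infinity>"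
  proof (rule nn_integral_PInf_AE)
    show "(\<lambda>\<omega>. ennreal_of_enat (return_time orbit x \<omega>)) \<in> borel_measurable S"
      unfolding return_time_eq by measurable
    show "(\<integral>\<^sup>+\<omega>. ennreal_of_enat (return_time orbit x \<omega>) \<partial>S) \<noteq> \<infinity>"
      using rec by (simp add: positive_recurrent_state_def)
  qed
  moreover have "AE \<omega> in S. \<forall>k. \<omega> k \<in> set_pmf I"
  proof -
    have "AE \<omega> in S. \<omega> k \<in> set_pmf I" for k
      by (rule AE_PiM_component) (auto simp: prob_space_measure_pmf AE_measure_pmf)
    then show ?thesis by (simp add: AE_all_countable)
  qed
  ultimately have "AE \<omega> in S.
      (\<Sum>k. of_nat (\<alpha> (\<omega> k)) * indicator {\<omega>. avoids {x} k x \<omega>} \<omega> :: ennreal) \<le>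
      (\<Sum>k. of_nat (\<beta> (\<omega> k)) * indicator {\<omega>. avoids {x} k x \<omega>} \<omega>)"
  proof eventually_elim
    case (elim \<omega>)
    have "\<exists>k\<ge>1. orbit x k \<omega> \<in> {x}"
    proof (rule ccontr)
      assume "\<not> ?thesis"
      then have none: "{enat k | k. 1 \<le> k \<and> orbit x k \<omega> = x} = {}" by auto
      show False using elim(1) unfolding return_time_def none by (simp add: top_enat_def)
    qed
    from avoids_hit[OF this] obtain n
      where n: "orbit x n \<omega> \<in> {x}" "\<forall>k. avoids {x} k x \<omega> \<longleftrightarrow> k < n" by blast
    have stopped: "(\<Sum>k. of_nat (\<gamma> (\<omega> k)) * indicator {\<omega>. avoids {x} k x \<omega>} \<omega> :: ennreal) =
        of_nat (\<Sum>k<n. \<gamma> (\<omega> k))" for \<gamma>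
      by (subst suminf_finite[of "{..<n}"]) (auto simp: n(2))
    \<comment> \<open>The step inequality telescopes along the orbit. At the return time
      \<open>n\<close> the orbit is back at \<open>x\<close>, so the two values of \<open>L\<close>
      cancel.\<close>
    have "L x + (\<Sum>k<m. \<alpha> (\<omega> k)) \<le> L (orbit x m \<omega>) + (\<Sum>k<m. \<beta> (\<omega> k))" for m
    proof (induction m)
      case (Suc m)
      then show ?case using step[of "\<omega> m" "orbit x m \<omega>"] elim by (simp add: algebra_simps)
    qed simp
    from this[of n] n(1) show ?case unfolding stopped by (simp del: of_nat_sum)
  qed
  then have "(\<integral>\<^sup>+i. of_nat (\<alpha> i) \<partial>measure_pmf I) * ?T \<le> (\<integral>\<^sup>+i. of_nat (\<beta> i) \<partial>measure_pmf I) * ?T"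
    unfolding wald[symmetric] by (rule nn_integral_mono_AE)
  \<comment> \<open>The common factor \<open>?T\<close> can be cancelled because it is finite and
    its term for \<open>k = 0\<close> equals 1.\<close>
  moreover have "?T \<noteq> 0"
  proof
    assume "?T = 0"
    then have "\<forall>k. avoid_prob {x} k x = 0"
      by (subst (asm) suminf_eq_zero_iff) auto
    then have "avoid_prob {x} 0 x = 0" ..
    then show False by simp
  qed
  ultimately show ?thesis using T
    by (simp add: ennreal_mult_le_mult_iff mult.commute[of _ ?T])
qed


section \<open>Foster's criterion\<close>

text \<open>Only single transitions of positive probability; reachability in several steps is
  expressed by the closures of this relation.\<close>

definition reach :: "('x \<times> 'x) set" where
  "reach = {(x, y). y \<in> f x ` set_pmf I}"

text \<open>Induction backwards along the path: if one successor of positive probability has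
  avoidance probability below 1 for some horizon \<open>k\<close>, then averaging keeps the value at
  \<open>x\<close> below 1 for horizon \<open>Suc k\<close>.\<close>

lemma avoid_prob_less_1:
  assumes "(x, y) \<in> reach\<^sup>+" "y \<in> G"
  shows "\<exists>k. avoid_prob G k x < 1"
proof -
  have less: "(\<integral>\<^sup>+i. h i \<partial>measure_pmf I) < 1" if "\<And>i. h i \<le> 1" "i \<in> set_pmf I" "h i < 1" for h i
  proof -
    have "(\<integral>\<^sup>+i. h i \<partial>measure_pmf I) \<le> (\<integral>\<^sup>+i. 1 \<partial>measure_pmf I)"
      by (intro nn_integral_mono that)
    then have "(\<integral>\<^sup>+i. h i \<partial>measure_pmf I) \<noteq> \<infinity>"
      by (auto simp: measure_pmf.emeasure_space_1 top_unique)
    moreover have "\<not> (AE i in measure_pmf I. 1 \<le> h i)"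
      using that(2,3) by (auto simp: AE_measure_pmf_iff not_le)
    ultimately have "(\<integral>\<^sup>+i. h i \<partial>measure_pmf I) < (\<integral>\<^sup>+i. 1 \<partial>measure_pmf I)"
      by (intro nn_integral_less) (auto simp: that)
    then show ?thesis by (simp add: measure_pmf.emeasure_space_1)
  qed
  from assms show ?thesis
  proof (induction rule: converse_trancl_induct)
    case (base x)
    then obtain i where i: "i \<in> set_pmf I" "f x i \<in> G" by (auto simp: reach_def)
    have "avoid_prob G (Suc 0) x < 1"
      unfolding avoid_prob_Suc by (rule less[OF _ i(1)]) (use i in \<open>auto simp: indicator_def\<close>)
    then show ?case ..
  next
    case (step x x')
    then obtain k where k: "avoid_prob G k x' < 1" by auto
    from step obtain i where i: "i \<in> set_pmf I" "f x i = x'" by (auto simp: reach_def)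
    have "avoid_prob G (Suc k) x < 1"
      unfolding avoid_prob_Suc
      by (rule less[OF _ i(1)]) (use i k in \<open>auto simp: indicator_def avoid_prob_le_1\<close>)
    then show ?case ..
  qed
qed

text \<open>\<open>W\<close> is a supersolution of the first-step equation for the expected hitting
  time. The partial sums are the iterates of that equation started from 0, so they stay below
  \<open>W\<close>. The closed set \<open>C\<close> makes it enough to have the inequality on
  \<open>C\<close>.\<close>

lemma suminf_avoid_prob_le:
  assumes closed: "\<And>x i. x \<in> C \<Longrightarrow> i \<in> set_pmf I \<Longrightarrow> f x i \<in> C"
    and super: "\<And>x. x \<in> C \<Longrightarrow>
      1 + (\<integral>\<^sup>+i. indicator (- G) (f x i) * W (f x i) \<partial>measure_pmf I) \<le> W x"
    and "x \<in> C"
  shows "(\<Sum>k. avoid_prob G k x) \<le> W x"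
proof -
  have "(\<Sum>k<n. avoid_prob G k x) \<le> W x" if "x \<in> C" for n x
    using that
  proof (induction n arbitrary: x)
    case (Suc n)
    have "(\<Sum>k<Suc n. avoid_prob G k x) =
        1 + (\<integral>\<^sup>+i. indicator (- G) (f x i) * (\<Sum>k<n. avoid_prob G k (f x i)) \<partial>measure_pmf I)"
      unfolding sum.lessThan_Suc_shift avoid_prob_Suc sum_distrib_left
      by (subst nn_integral_sum) auto
    also have "\<dots> \<le> 1 + (\<integral>\<^sup>+i. indicator (- G) (f x i) * W (f x i) \<partial>measure_pmf I)"
      by (intro add_left_mono nn_integral_mono_AE)
        (auto simp: AE_measure_pmf_iff intro!: mult_left_mono Suc.IH closed Suc.prems)
    also have "\<dots> \<le> W x" by (rule super[OF Suc.prems])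
    finally show ?case .
  qed simp
  with \<open>x \<in> C\<close> show ?thesis by (auto simp: suminf_eq_SUP intro!: SUP_least)
qed

text \<open>One horizon and one finite constant serve all of \<open>F\<close>: the constants of the
  single points are added and the larger horizon is taken. Neither change hurts, as
  \<open>avoid_prob\<close> decreases in the horizon and is at most 1.\<close>

lemma uniform_hitting:
  assumes "finite F" "\<And>x. x \<in> F \<Longrightarrow> \<exists>k. avoid_prob G k x < 1" and c: "c < \<infinity>"
  shows "\<exists>\<beta> m. \<beta> < \<infinity> \<and> (\<forall>x\<in>F. c + \<beta> * avoid_prob G m x \<le> \<beta>)"
  using assms(1,2)
proof induction
  case empty
  then show ?case by (auto intro!: exI[of _ 0])
next
  case (insert y F)
  then obtain \<beta> m where \<beta>: "\<beta> < \<infinity>" "\<And>x. x \<in> F \<Longrightarrow> c + \<beta> * avoid_prob G m x \<le> \<beta>" by auto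
  obtain k where k: "avoid_prob G k y < 1" using insert.prems by auto
  obtain r where r: "avoid_prob G k y = ennreal r" "0 \<le> r"
    using k by (cases "avoid_prob G k y") auto
  with k have r1: "r < 1" by simp
  obtain c' where c': "c = ennreal c'" "0 \<le> c'"
    using c by (cases c) auto
  \<comment> \<open>The solution of \<open>c + \<gamma> * r = \<gamma>\<close>, which exists because
    \<open>r < 1\<close>.\<close>
  define \<gamma> where "\<gamma> = ennreal (c' / (1 - r))"
  have \<gamma>: "\<gamma> < \<infinity>" "c + \<gamma> * avoid_prob G k y = \<gamma>"
    unfolding \<gamma>_def r c' using r1 r(2) c'(2)
    by (auto simp: ennreal_mult[symmetric] ennreal_plus[symmetric] field_simps simp del: ennreal_plus)
  have mono: "c + (\<epsilon> + \<delta>) * avoid_prob G (max m k) x \<le> \<epsilon> + \<delta>"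
    if "c + \<epsilon> * avoid_prob G j x \<le> \<epsilon>" "j \<le> max m k" for \<epsilon> \<delta> j x
  proof -
    have "c + (\<epsilon> + \<delta>) * avoid_prob G (max m k) x =
        (c + \<epsilon> * avoid_prob G (max m k) x) + \<delta> * avoid_prob G (max m k) x"
      by (simp add: algebra_simps)
    also have "\<dots> \<le> (c + \<epsilon> * avoid_prob G j x) + \<delta> * 1"
      by (intro add_mono mult_left_mono order_refl avoid_prob_antimono that avoid_prob_le_1) auto
    also have "\<dots> \<le> \<epsilon> + \<delta>" using that(1) by (simp add: add_right_mono)
    finally show ?thesis .
  qed
  show ?case
  proof (intro exI conjI ballI)
    show "\<beta> + \<gamma> < \<infinity>" using \<beta> \<gamma> by simp
    fix x assume "x \<in> insert y F"
    then show "c + (\<beta> + \<gamma>) * avoid_prob G (max m k) x \<le> \<beta> + \<gamma>"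
      using mono[of \<beta> m x \<gamma>] mono[of \<gamma> k x \<beta>] \<beta>(2)[of x] \<gamma>(2)
      by (auto simp: add.commute[of \<gamma>])
  qed
qed

text \<open>
  The drift of \<open>V\<close> is only controlled outside \<open>F\<close>. Adding a large multiple of the expected time,
  truncated at \<open>m\<close>, until \<open>G\<close> is hit repairs this on \<open>F\<close>: that function has drift
  \<open>- (1 - avoid_prob G m x)\<close>.
\<close>

lemma suminf_avoid_prob_finite:
  assumes closed: "\<And>x i. x \<in> C \<Longrightarrow> i \<in> set_pmf I \<Longrightarrow> f x i \<in> C"
    and drift: "\<And>x. x \<in> C \<Longrightarrow> 1 + (\<integral>\<^sup>+i. V (f x i) \<partial>measure_pmf I) \<le> V x + c * indicator F x"
    and V: "\<And>x. V x < \<infinity>" and c: "c < \<infinity>"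
    and F: "finite F" and reach: "\<And>x. x \<in> C \<inter> F \<Longrightarrow> \<exists>y\<in>G. (x, y) \<in> reach\<^sup>+"
    and x: "x \<in> C"
  shows "(\<Sum>k. avoid_prob G k x) < \<infinity>"
proof -
  have "\<exists>k. avoid_prob G k x < 1" if "x \<in> C \<inter> F" for x
    using reach[OF that] avoid_prob_less_1 by blast
  then obtain \<beta> m where \<beta>: "\<beta> < \<infinity>"
    and m: "\<And>x. x \<in> C \<inter> F \<Longrightarrow> c + \<beta> * avoid_prob G m x \<le> \<beta>"
    using uniform_hitting[of "C \<inter> F" G c] F c by auto
  define W where "W x = V x + \<beta> * (\<Sum>k<m. avoid_prob G k x)" for x
  have "(\<Sum>k. avoid_prob G k x) \<le> W x"
  proof (rule suminf_avoid_prob_le[OF closed _ x])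
    fix x assume x: "x \<in> C"
    have "1 + (\<integral>\<^sup>+i. indicator (- G) (f x i) * W (f x i) \<partial>measure_pmf I) =
        1 + (\<integral>\<^sup>+i. indicator (- G) (f x i) * V (f x i) \<partial>measure_pmf I) +
          \<beta> * (\<Sum>k<m. avoid_prob G (Suc k) x)"
      by (simp add: W_def algebra_simps nn_integral_add nn_integral_sum nn_integral_cmult
          sum_distrib_left avoid_prob_Suc)
    also have "\<dots> \<le> 1 + (\<integral>\<^sup>+i. V (f x i) \<partial>measure_pmf I) + \<beta> * (\<Sum>k<m. avoid_prob G (Suc k) x)"
      by (intro add_mono order_refl nn_integral_mono) (auto simp: indicator_def)
    also have "\<dots> \<le> V x + c * indicator F x + \<beta> * (\<Sum>k<m. avoid_prob G (Suc k) x)"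
      by (intro add_right_mono drift x)
    also have "\<dots> \<le> W x"
    proof -
      \<comment> \<open>Moving one step ahead loses the term 1 for \<open>k = 0\<close> and gains
        \<open>avoid_prob G m x\<close>. The identity is kept additive; below, \<beta> is added to
        both sides and cancelled at the end, since it is finite.\<close>
      have tele: "(\<Sum>k<m. avoid_prob G (Suc k) x) + 1 = (\<Sum>k<m. avoid_prob G k x) + avoid_prob G m x"
        using sum.lessThan_Suc_shift[of "\<lambda>k. avoid_prob G k x" m] by (simp add: add.commute)
      have "c * indicator F x + \<beta> * (\<Sum>k<m. avoid_prob G (Suc k) x) \<le> \<beta> * (\<Sum>k<m. avoid_prob G k x)"
      proof (cases "x \<in> F")
        case True
        have "(c + \<beta> * (\<Sum>k<m. avoid_prob G (Suc k) x)) + \<beta> =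
            c + \<beta> * ((\<Sum>k<m. avoid_prob G (Suc k) x) + 1)"
          by (simp add: algebra_simps)
        also have "\<dots> = (c + \<beta> * avoid_prob G m x) + \<beta> * (\<Sum>k<m. avoid_prob G k x)"
          unfolding tele by (simp add: algebra_simps)
        also have "\<dots> \<le> \<beta> * (\<Sum>k<m. avoid_prob G k x) + \<beta>"
          using m[of x] True x by (simp add: add.commute add_right_mono)
        finally show ?thesis
          using True \<beta> by (auto simp: ennreal_add_left_cancel_le add.commute[of _ \<beta>])
      next
        case False
        then show ?thesis
          by (auto intro!: mult_left_mono sum_mono avoid_prob_Suc_le)
      qed
      then show ?thesis by (simp add: W_def add.assoc add_left_mono)
    qed
    finally show "1 + (\<integral>\<^sup>+i. indicator (- G) (f x i) * W (f x i) \<partial>measure_pmf I) \<le> W x" .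
  qed
  also have "W x < \<infinity>"
  proof -
    have "(\<Sum>k<m. avoid_prob G k x) < \<infinity>"
      by (simp add: less_top[symmetric])
    then show ?thesis using V \<beta> by (simp add: W_def ennreal_mult_less_top)
  qed
  finally show ?thesis .
qed

text \<open>Irreducibility is replaced by the set \<open>E\<close> of those points of
  \<open>F\<close> to which everything reachable from them leads back. Points of \<open>E\<close>
  return to themselves in finite mean time, and every state hits \<open>E\<close> in finite mean
  time; both follow from \<open>suminf_avoid_prob_finite\<close>.\<close>

theorem foster_positive_recurrent:
  assumes drift: "\<And>x. 1 + (\<integral>\<^sup>+i. V (f x i) \<partial>measure_pmf I) \<le> V x + c * indicator F x"
    and V: "\<And>x. V x < \<infinity>" and c: "c < \<infinity>" and F: "finite F"
  shows "positive_recurrent S orbit"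
proof -
  define E where "E = {z \<in> F. \<forall>u. (z, u) \<in> reach\<^sup>* \<longrightarrow> (u, z) \<in> reach\<^sup>*}"
  have succ: "\<exists>y. (x, y) \<in> reach" for x
    using set_pmf_not_empty[of I] by (auto simp: reach_def)
  have closed: "f y i \<in> {y. (x, y) \<in> reach\<^sup>*}" if "y \<in> {y. (x, y) \<in> reach\<^sup>*}" "i \<in> set_pmf I" for x y i
  proof -
    have "(y, f y i) \<in> reach" using that by (auto simp: reach_def)
    with that show ?thesis by (auto intro: rtrancl_into_rtrancl)
  qed
  \<comment> \<open>If \<open>F\<close> were unreachable, the mean of \<open>V\<close> would drop by
    at least 1 from every reachable state. This fails at a reachable \<open>y\<close> whose value is
    less than 1 above the infimum \<open>v\<close>.\<close>
  have reach_F: "\<exists>z\<in>F. (x, z) \<in> reach\<^sup>*" for x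
  proof (rule ccontr)
    let ?R = "{y. (x, y) \<in> reach\<^sup>*}"
    assume none: "\<not> (\<exists>z\<in>F. (x, z) \<in> reach\<^sup>*)"
    define v where "v = Inf (V ` ?R)"
    have "v \<le> V x" unfolding v_def by (intro Inf_lower) auto
    then have "v < v + 1" using V[of x] by (cases v) (auto simp: less_top)
    then obtain y where y: "(x, y) \<in> reach\<^sup>*" "V y < v + 1"
      by (auto simp: v_def Inf_less_iff)
    have "1 + v = 1 + (\<integral>\<^sup>+i. v \<partial>measure_pmf I)" by (simp add: measure_pmf.emeasure_space_1)
    also have "\<dots> \<le> 1 + (\<integral>\<^sup>+i. V (f y i) \<partial>measure_pmf I)"
      using closed[of y x] y
      by (intro add_left_mono nn_integral_mono_AE) (auto simp: AE_measure_pmf_iff v_def intro!: Inf_lower)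
    also have "\<dots> \<le> V y" using drift[of y] none y by auto
    finally show False using y(2) by (simp add: add.commute)
  qed
  \<comment> \<open>Choose \<open>z\<close> in \<open>F\<close>, reachable from \<open>x\<close>,
    that reaches as few points of \<open>F\<close> as possible. Whatever follows \<open>z\<close>
    leads to some \<open>w\<close> in \<open>F\<close>, which by minimality reaches the same points
    of \<open>F\<close> as \<open>z\<close>, in particular \<open>z\<close> itself.\<close>
  have reach_E: "\<exists>z\<in>E. (x, z) \<in> reach\<^sup>*" for x
  proof -
    define N where "N z = card {w \<in> F. (z, w) \<in> reach\<^sup>*}" for z
    obtain z where z: "z \<in> F" "(x, z) \<in> reach\<^sup>*"
      and min: "\<And>w. w \<in> F \<Longrightarrow> (x, w) \<in> reach\<^sup>* \<Longrightarrow> N z \<le> N w"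
      using reach_F[of x] ex_has_least_nat[of "\<lambda>z. z \<in> F \<and> (x, z) \<in> reach\<^sup>*" _ N] by blast
    have "(u, z) \<in> reach\<^sup>*" if u: "(z, u) \<in> reach\<^sup>*" for u
    proof -
      obtain w where w: "w \<in> F" "(u, w) \<in> reach\<^sup>*" using reach_F by blast
      have zw: "(z, w) \<in> reach\<^sup>*" using u w by auto
      have "{v \<in> F. (w, v) \<in> reach\<^sup>*} = {v \<in> F. (z, v) \<in> reach\<^sup>*}"
      proof (rule card_seteq)
        show "card {v \<in> F. (z, v) \<in> reach\<^sup>*} \<le> card {v \<in> F. (w, v) \<in> reach\<^sup>*}"
          using min[OF w(1) rtrancl_trans[OF z(2) zw]] unfolding N_def .
      qed (use F zw in auto)
      then have "(w, z) \<in> reach\<^sup>*" using z(1) by blast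
      with w show ?thesis by auto
    qed
    with z show ?thesis by (auto simp: E_def)
  qed
  have recurrent: "positive_recurrent_state S orbit z" if z: "z \<in> E" for z
    unfolding positive_recurrent_state_iff
  proof (rule suminf_avoid_prob_finite[OF closed drift V c F])
    fix y assume y: "y \<in> {y. (z, y) \<in> reach\<^sup>*} \<inter> F"
    \<comment> \<open>A first step is taken so that the path to \<open>z\<close> has positive length
      even if \<open>y = z\<close>.\<close>
    obtain u where u: "(y, u) \<in> reach" using succ by blast
    with y have "(z, u) \<in> reach\<^sup>*" by auto
    with z have "(u, z) \<in> reach\<^sup>*" by (auto simp: E_def)
    with u show "\<exists>w\<in>{z}. (y, w) \<in> reach\<^sup>+" by auto
  qed auto
  show ?thesis
    unfolding positive_recurrent_def
  proof
    fix x
    have "(\<Sum>k. avoid_prob E k x) < \<infinity>"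
    proof (rule suminf_avoid_prob_finite[where C = UNIV, OF _ drift V c F])
      fix y
      obtain u where u: "(y, u) \<in> reach" using succ by blast
      with reach_E[of u] show "\<exists>w\<in>E. (y, w) \<in> reach\<^sup>+" by (meson rtrancl_into_trancl2)
    qed auto
    then have "AE \<omega> in S. (\<Sum>k. indicator {\<omega>. avoids E k x \<omega>} \<omega> :: ennreal) \<noteq> \<infinity>"
      by (intro nn_integral_PInf_AE) (auto simp: nn_integral_suminf_avoids)
    then show "AE \<omega> in S. \<exists>k. positive_recurrent_state S orbit (orbit x k \<omega>)"
    proof eventually_elim
      case (elim \<omega>)
      have "\<exists>k. orbit x k \<omega> \<in> E"
      proof (rule ccontr)
        assume "\<not> ?thesis"
        then have none: "{enat k | k. 1 \<le> k \<and> orbit x k \<omega> \<in> E} = {}" by auto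
        show False using elim unfolding suminf_avoids none by (simp add: top_enat_def)
      qed
      then show ?case using recurrent by blast
    qed
  qed
qed

end


section \<open>Order statistics and the stability region\<close>

text \<open>Sorting the servers by their mean, rather than sorting the values, turns partial sums of
  order statistics into sums over sets of servers.\<close>

lemma order_stat_enumeration:
  fixes \<mu> :: "'n::finite \<Rightarrow> real"
  obtains xs where "distinct xs" "set xs = UNIV" "sorted (map \<mu> xs)"
    "\<And>j. j \<le> CARD('n) \<Longrightarrow> (\<Sum>i=1..j. order_stat \<mu> i) = sum \<mu> (set (take j xs))"
proof -
  obtain ys :: "'n list" where ys: "set ys = UNIV" "distinct ys"
    using finite_distinct_list[of "UNIV :: 'n set"] by auto
  define xs where "xs = sort_key \<mu> ys"
  have xs: "set xs = UNIV" "distinct xs" "sorted (map \<mu> xs)"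
    using ys by (auto simp: xs_def)
  have len: "length xs = CARD('n)" using xs by (metis distinct_card)
  have "image_mset \<mu> (mset_set UNIV) = mset (map \<mu> xs)"
    using xs mset_set_set[of xs] by simp
  then have "sorted_list_of_multiset (image_mset \<mu> (mset_set UNIV)) = map \<mu> xs"
    using xs(3) by (simp only: sorted_list_of_multiset_mset sort_key_id_if_sorted[of "\<lambda>x. x", simplified])
  then have stat: "order_stat \<mu> i = \<mu> (xs ! (i - 1))" if "i \<in> {1..CARD('n)}" for i
    using that len by (cases i) (auto simp: order_stat_def)
  have "(\<Sum>i=1..j. order_stat \<mu> i) = sum \<mu> (set (take j xs))" if "j \<le> CARD('n)" for j
  proof -
    have "(\<Sum>i=1..j. order_stat \<mu> i) = (\<Sum>i=1..j. \<mu> (xs ! (i - 1)))"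
      using that by (intro sum.cong) (auto simp: stat)
    also have "\<dots> = (\<Sum>i<j. \<mu> (xs ! i))"
      by (rule sum.reindex_bij_witness[of _ Suc "\<lambda>i. i - 1"]) auto
    also have "\<dots> = sum_list (map \<mu> (take j xs))"
      using that len by (subst sum_list_sum_nth) (auto simp: atLeast0LessThan intro!: sum.cong)
    also have "\<dots> = sum \<mu> (set (take j xs))"
      using xs(2) by (simp add: sum_list_distinct_conv_sum_set)
    finally show ?thesis .
  qed
  with xs show thesis using that by blast
qed

lemma sum_order_stat_attained:
  fixes \<mu> :: "'n::finite \<Rightarrow> real"
  assumes "j \<le> CARD('n)"
  shows "\<exists>J. card J = j \<and> sum \<mu> J = (\<Sum>i=1..j. order_stat \<mu> i)"
proof -
  obtain xs where xs: "distinct xs" "set xs = UNIV"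
    "(\<Sum>i=1..j. order_stat \<mu> i) = sum \<mu> (set (take j xs))"
    using order_stat_enumeration[of \<mu>] assms by metis
  then have "card (set (take j xs)) = j"
    using assms by (metis distinct_card distinct_take length_take min.absorb2)
  with xs show ?thesis by metis
qed

text \<open>Exchange argument: with \<open>J\<close> the \<open>card T\<close> smallest servers,
  \<open>J - T\<close> and \<open>T - J\<close> have equal size, and any bijection between them maps
  to entries at least as large.\<close>

lemma sum_order_stat_le:
  fixes \<mu> :: "'n::finite \<Rightarrow> real"
  shows "(\<Sum>i=1..card T. order_stat \<mu> i) \<le> sum \<mu> T"
proof -
  have le: "card T \<le> CARD('n)" by (rule card_mono) auto
  obtain xs where xs: "distinct xs" "set xs = UNIV" "sorted (map \<mu> xs)"
    and sum: "(\<Sum>i=1..card T. order_stat \<mu> i) = sum \<mu> (set (take (card T) xs))"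
    using order_stat_enumeration[of \<mu>] le by metis
  define J where "J = set (take (card T) xs)"
  have len: "length xs = CARD('n)" using xs by (metis distinct_card)
  have card_J: "card J = card T"
    unfolding J_def using xs(1) le len by (metis distinct_card distinct_take length_take min.absorb2)
  have sep: "\<mu> i \<le> \<mu> j" if "i \<in> J" "j \<notin> J" for i j
  proof -
    from that(1) obtain k where k: "k < card T" "k < length xs" "i = xs ! k"
      by (auto simp: J_def in_set_conv_nth)
    obtain l where l: "l < length xs" "j = xs ! l"
      using xs(2) by (metis UNIV_I in_set_conv_nth)
    have "\<not> l < card T"
    proof
      assume "l < card T"
      then have "j \<in> J" using l by (auto simp: J_def in_set_conv_nth)
      with that show False by simp
    qed
    then show ?thesis
      using sorted_nth_mono[OF xs(3), of k l] k l by simp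
  qed
  have "card (J - T) = card (T - J)"
    using card_J by (simp add: card_Diff_subset_Int Int_commute)
  then obtain h where h: "bij_betw h (J - T) (T - J)"
    by (metis finite finite_same_card_bij)
  have "sum \<mu> (J - T) \<le> (\<Sum>i\<in>J - T. \<mu> (h i))"
    using h by (intro sum_mono sep) (auto dest: bij_betwE)
  also have "\<dots> = sum \<mu> (T - J)" by (rule sum.reindex_bij_betw[OF h])
  finally have "sum \<mu> (J - T) \<le> sum \<mu> (T - J)" .
  moreover have "sum \<mu> J = sum \<mu> (J \<inter> T) + sum \<mu> (J - T)" "sum \<mu> T = sum \<mu> (T \<inter> J) + sum \<mu> (T - J)"
    by (auto intro: sum.Int_Diff)
  ultimately show ?thesis unfolding sum J_def[symmetric] by (simp add: Int_commute)
qed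

text \<open>Extends the defining inequalities to all sets of servers: the smallest sums bound sets
  of intermediate size, the binomial coefficient vanishes below size \<open>d\<close>, and
  \<open>UNIV\<close> gives equality.\<close>

lemma stability_region_subset_sum:
  fixes \<mu> :: "'n::finite \<Rightarrow> real"
  assumes \<mu>: "\<mu> \<in> stability_region d" and d: "d \<le> CARD('n)" and pos: "sum \<mu> UNIV > 0"
  shows "sum \<mu> UNIV * (real (card T choose d) / real (CARD('n) choose d)) \<le> sum \<mu> T"
proof -
  have le: "card T \<le> CARD('n)" by (rule card_mono) auto
  consider "card T < d" | "d \<le> card T" "card T \<le> CARD('n) - 1" | "T = UNIV"
    using le card_subset_eq[of UNIV T] by fastforce
  then show ?thesis
  proof cases
    case 1
    then show ?thesis using \<mu> by (auto simp: binomial_eq_0 stability_region_def intro!: sum_nonneg)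
  next
    case 2
    then have "real (card T choose d) / real (CARD('n) choose d) \<le>
        (\<Sum>i=1..card T. order_stat \<mu> i) / sum \<mu> UNIV"
      using \<mu> by (auto simp: stability_region_def)
    also have "\<dots> \<le> sum \<mu> T / sum \<mu> UNIV"
      using sum_order_stat_le[of \<mu> T] pos by (intro divide_right_mono) auto
    finally show ?thesis using pos by (simp add: field_simps)
  next
    case 3
    then show ?thesis using d by simp
  qed
qed


section \<open>The load balancing system\<close>

definition queue_step ::
  "('r \<Rightarrow> ('n \<Rightarrow> nat) \<Rightarrow> 'n) \<Rightarrow> ('n \<Rightarrow> nat) \<Rightarrow> ('n, 'r) slot_input \<Rightarrow> 'n \<Rightarrow> nat" where
  "queue_step route q z = (case z of (a, s, r) \<Rightarrow> next_queue q (arrivals a (route r q)) s)"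

lemma queue_step_apply:
  "queue_step route q (a, s, r) i = q i + arrivals a (route r q) i - s i"
  unfolding queue_step_def next_queue_def unused_service_def by simp

text \<open>Makes the results on random recursions available. The state type is countable because
  there are finitely many servers.\<close>

lemma queue_process_orbit:
  fixes route :: "'r \<Rightarrow> ('n::finite \<Rightarrow> nat) \<Rightarrow> 'n"
  shows "queue_process route = random_recursion.orbit (queue_step route)"
proof (intro ext)
  fix q k \<omega> i
  have "queue_process route q k \<omega> = random_recursion.orbit (queue_step route) q k \<omega>"
    by (induction k) (auto simp: random_recursion.orbit.simps queue_step_def split: prod.splits)
  then show "queue_process route q k \<omega> i = random_recursion.orbit (queue_step route) q k \<omega> i"
    by simp
qed

section \<open>The sampled set and the shortest sampled queue\<close>

lemma set_pmf_power_of_d_randomness: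
  fixes r :: "'n::finite set \<times> ('n set \<Rightarrow> 'n)"
  assumes "r \<in> set_pmf (power_of_d_randomness d)" "1 \<le> d" "d \<le> CARD('n)"
  shows "power_of_d_route r q \<in> shortest (fst r) q"
proof -
  have "\<exists>D :: 'n set. card D = d"
    using assms(3) obtain_subset_with_card_n[of d "UNIV :: 'n set"] by blast
  then have "set_pmf (pmf_of_set {D :: 'n set. card D = d}) = {D. card D = d}"
    by (intro set_pmf_of_set) auto
  with assms(1) have "card (fst r) = d"
    and snd: "snd r \<in> set_pmf (Pi_pmf (UNIV - {{}}) undefined pmf_of_set)"
    unfolding power_of_d_randomness_def set_pair_pmf mem_Times_iff by simp_all
  with assms(2) have "fst r \<noteq> {}" by auto
  then obtain i where "i \<in> fst r" "\<And>j. j \<in> fst r \<Longrightarrow> q i \<le> q j"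
    using arg_min_if_finite(1)[of "fst r" q] arg_min_least[of "fst r" _ q] by (metis finite)
  then have ne: "shortest (fst r) q \<noteq> {}" by (auto simp: shortest_def)
  with snd have "snd r (shortest (fst r) q) \<in> set_pmf (pmf_of_set (shortest (fst r) q))"
    by (simp add: set_Pi_pmf PiE_dflt_def)
  with ne show ?thesis by (simp add: power_of_d_route_def case_prod_beta)
qed

lemma prob_sample_subset:
  fixes T :: "'n::finite set"
  assumes "d \<le> CARD('n)"
  shows "(\<integral>\<^sup>+r. indicator {r. fst r \<subseteq> T} r \<partial>measure_pmf (power_of_d_randomness d)) =
    ennreal (real (card T choose d) / real (CARD('n) choose d))"
proof -
  have "\<exists>D :: 'n set. card D = d"
    using assms obtain_subset_with_card_n[of d "UNIV :: 'n set"] by blast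
  then have ne: "{D :: 'n set. card D = d} \<noteq> {}" by auto
  have "(\<integral>\<^sup>+r. indicator {r. fst r \<subseteq> T} r \<partial>measure_pmf (power_of_d_randomness d)) =
      (\<integral>\<^sup>+D. indicator {D. D \<subseteq> T} D \<partial>measure_pmf (map_pmf fst (power_of_d_randomness d)))"
    by (simp add: nn_integral_map_pmf indicator_def)
  also have "map_pmf fst (power_of_d_randomness d) = pmf_of_set {D :: 'n set. card D = d}"
    by (simp add: power_of_d_randomness_def map_fst_pair_pmf)
  also have "(\<integral>\<^sup>+D. indicator {D. D \<subseteq> T} D \<partial>measure_pmf (pmf_of_set {D :: 'n set. card D = d})) =
      ennreal (real (card ({D. card D = d} \<inter> {D. D \<subseteq> T})) / real (card {D :: 'n set. card D = d}))"
    using ne by (simp add: emeasure_pmf_of_set)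
  also have "{D. card D = d} \<inter> {D. D \<subseteq> T} = {D. D \<subseteq> T \<and> card D = d}" by auto
  also have "card {D. D \<subseteq> T \<and> card D = d} = card T choose d" by (rule n_subsets) simp
  also have "card {D :: 'n set. card D = d} = CARD('n) choose d"
    using n_subsets[of "UNIV :: 'n set" d] by simp
  finally show ?thesis .
qed

lemma shortest_sampled_queue:
  fixes \<mu> :: "'n::finite \<Rightarrow> real" and q :: "'n \<Rightarrow> nat"
  assumes \<mu>: "\<mu> \<in> stability_region d" and d: "1 \<le> d" "d \<le> CARD('n)" and pos: "sum \<mu> UNIV > 0"
  shows "(\<integral>\<^sup>+r. of_nat (q (power_of_d_route r q)) \<partial>measure_pmf (power_of_d_randomness d)) \<le>
    ennreal ((\<Sum>i\<in>UNIV. \<mu> i * q i) / sum \<mu> UNIV)"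
proof -
  define N where "N = Max (range q)"
  have N: "q i \<le> N" for i unfolding N_def by (rule Max_ge) auto
  define T where "T t = {i. t < q i}" for t
  have "of_nat (q (power_of_d_route r q)) = (\<Sum>t<N. indicator {r. fst r \<subseteq> T t} r :: ennreal)"
    if r: "r \<in> set_pmf (power_of_d_randomness d)" for r
  proof -
    have route: "power_of_d_route r q \<in> fst r" "\<And>j. j \<in> fst r \<Longrightarrow> q (power_of_d_route r q) \<le> q j"
      using set_pmf_power_of_d_randomness[OF r d, of q] by (auto simp: shortest_def)
    \<comment> \<open>The minimum over the sample exceeds \<open>t\<close> exactly when the whole
      sample lies in the level set.\<close>
    then have "fst r \<subseteq> T t \<longleftrightarrow> t < q (power_of_d_route r q)" for t
      by (force simp: T_def)
    then have "(\<Sum>t<N. indicator {r. fst r \<subseteq> T t} r :: ennreal) =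
        of_nat (card ({..<N} \<inter> {t. t < q (power_of_d_route r q)}))"
      by (simp add: indicator_def sum.If_cases)
    also have "{..<N} \<inter> {t. t < q (power_of_d_route r q)} = {..<q (power_of_d_route r q)}"
      using N[of "power_of_d_route r q"] by auto
    finally show ?thesis by simp
  qed
  then have "(\<integral>\<^sup>+r. of_nat (q (power_of_d_route r q)) \<partial>measure_pmf (power_of_d_randomness d)) =
      (\<integral>\<^sup>+r. (\<Sum>t<N. indicator {r. fst r \<subseteq> T t} r) \<partial>measure_pmf (power_of_d_randomness d))"
    by (intro nn_integral_cong_AE) (auto simp: AE_measure_pmf_iff)
  also have "\<dots> = (\<Sum>t<N. ennreal (real (card (T t) choose d) / real (CARD('n) choose d)))"
    unfolding prob_sample_subset[OF d(2), symmetric] by (rule nn_integral_sum) simp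
  also have "\<dots> \<le> (\<Sum>t<N. ennreal (sum \<mu> (T t) / sum \<mu> UNIV))"
    using stability_region_subset_sum[OF \<mu> d(2) pos] pos
    by (intro sum_mono ennreal_leI) (simp add: field_simps)
  also have "\<dots> = ennreal (\<Sum>t<N. sum \<mu> (T t) / sum \<mu> UNIV)"
    using \<mu> pos by (intro sum_ennreal) (auto simp: stability_region_def intro!: divide_nonneg_pos sum_nonneg)
  also have "(\<Sum>t<N. sum \<mu> (T t) / sum \<mu> UNIV) = (\<Sum>i\<in>UNIV. \<mu> i * q i) / sum \<mu> UNIV"
  proof -
    have "(\<Sum>t<N. sum \<mu> (T t)) = (\<Sum>t<N. \<Sum>i\<in>UNIV. if t < q i then \<mu> i else 0)"
      by (simp add: T_def sum.If_cases)
    also have "\<dots> = (\<Sum>i\<in>UNIV. \<Sum>t<N. if t < q i then \<mu> i else 0)" by (rule sum.swap)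
    also have "\<dots> = (\<Sum>i\<in>UNIV. \<mu> i * q i)"
    proof (rule sum.cong[OF refl])
      fix i
      have "{..<N} \<inter> {t. t < q i} = {..<q i}" using N[of i] by auto
      then show "(\<Sum>t<N. if t < q i then \<mu> i else 0) = \<mu> i * q i"
        by (simp add: sum.If_cases)
    qed
    finally show ?thesis by (simp add: sum_divide_distrib[symmetric])
  qed
  finally show ?thesis .
qed


section \<open>Moments and the quadratic drift\<close>

lemma nn_integral_of_nat_pmf:
  fixes g :: "'a \<Rightarrow> nat"
  assumes "integrable (measure_pmf p) (\<lambda>x. real (g x))"
  shows "(\<integral>\<^sup>+x. of_nat (g x) \<partial>measure_pmf p) = ennreal (measure_pmf.expectation p (\<lambda>x. real (g x)))"
  using nn_integral_eq_integral[OF assms] by (simp add: ennreal_of_nat_eq_real_of_nat)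

lemma integrable_of_nat_square:
  fixes g :: "'a \<Rightarrow> nat"
  assumes "integrable (measure_pmf p) (\<lambda>x. (real (g x))\<^sup>2)"
  shows "integrable (measure_pmf p) (\<lambda>x. real (g x))"
proof (rule Bochner_Integration.integrable_bound[OF assms])
  have "g x \<le> (g x)\<^sup>2" for x by (cases "g x") (auto simp: power2_eq_square)
  then have "real (g x) \<le> (real (g x))\<^sup>2" for x
    by (metis of_nat_le_iff of_nat_power)
  then show "AE x in measure_pmf p. norm (real (g x)) \<le> norm ((real (g x))\<^sup>2)"
    by simp
qed simp

text \<open>Positive weights bound every coordinate. This supplies the finite exceptional set for
  Foster's criterion.\<close>

lemma finite_weighted_sublevel:
  fixes w :: "'n::finite \<Rightarrow> real"
  assumes w: "\<And>i. w i > 0"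
  shows "finite {q :: 'n \<Rightarrow> nat. (\<Sum>i\<in>UNIV. w i * q i) < B}"
proof (rule finite_subset)
  show "finite (Pi\<^sub>E UNIV (\<lambda>i. {..nat \<lceil>B / w i\<rceil>}))"
    by (rule finite_PiE) auto
  show "{q :: 'n \<Rightarrow> nat. (\<Sum>i\<in>UNIV. w i * q i) < B} \<subseteq> Pi\<^sub>E UNIV (\<lambda>i. {..nat \<lceil>B / w i\<rceil>})"
  proof
    fix q :: "'n \<Rightarrow> nat" assume q: "q \<in> {q. (\<Sum>i\<in>UNIV. w i * q i) < B}"
    have "q i \<le> nat \<lceil>B / w i\<rceil>" for i
    proof -
      have "w i * q i \<le> (\<Sum>i\<in>UNIV. w i * q i)"
        using w by (intro member_le_sum) (auto simp: less_imp_le)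
      with q have "w i * q i < B" by simp
      then have "real (q i) < B / w i" using w[of i] by (simp add: field_simps)
      then show ?thesis by linarith
    qed
    then show "q \<in> Pi\<^sub>E UNIV (\<lambda>i. {..nat \<lceil>B / w i\<rceil>})" by auto
  qed
qed

lemma sum_arrivals: "finite J \<Longrightarrow> (\<Sum>i\<in>J. arrivals a k i) = (if k \<in> J then a else 0)"
  by (simp add: arrivals_def)

lemma queue_step_square:
  fixes q s :: "'n::finite \<Rightarrow> nat"
  shows "(\<Sum>i\<in>UNIV. (queue_step route q (a, s, r) i)\<^sup>2) + 2 * (\<Sum>i\<in>UNIV. q i * s i) \<le>
    (\<Sum>i\<in>UNIV. (q i)\<^sup>2) + 2 * (a * q (route r q)) + a\<^sup>2 + (\<Sum>i\<in>UNIV. (s i)\<^sup>2)"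
proof -
  \<comment> \<open>If the service does not exceed the available jobs, expand the square and drop
    the cross term \<open>2 * b * c\<close>. Otherwise the queue empties and the
    arithmetic-geometric inequality for \<open>x\<close> and \<open>c\<close> suffices.\<close>
  have sq: "(x + b - c)\<^sup>2 + 2 * (x * c) \<le> x\<^sup>2 + 2 * (b * x) + b\<^sup>2 + c\<^sup>2" for x b c :: nat
  proof (cases "c \<le> x + b")
    case True
    then obtain k where k: "x + b = c + k" using le_Suc_ex by blast
    have "x\<^sup>2 + 2 * (b * x) + b\<^sup>2 = (c + k)\<^sup>2"
      unfolding k[symmetric] by (simp add: power2_sum)
    moreover have "x * c \<le> (c + k) * c" unfolding k[symmetric] by simp
    ultimately show ?thesis unfolding k by (simp add: power2_eq_square algebra_simps)
  next
    case False
    have "int (2 * (x * c)) \<le> int (x\<^sup>2 + c\<^sup>2)"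
      using zero_le_power2[of "int x - int c"] by (simp add: power2_eq_square algebra_simps)
    then have "2 * (x * c) \<le> x\<^sup>2 + c\<^sup>2" by (simp only: of_nat_le_iff)
    with False show ?thesis by simp
  qed
  let ?b = "arrivals a (route r q)"
  have "(\<Sum>i\<in>UNIV. (queue_step route q (a, s, r) i)\<^sup>2 + 2 * (q i * s i)) \<le>
      (\<Sum>i\<in>UNIV. (q i)\<^sup>2 + 2 * (?b i * q i) + (?b i)\<^sup>2 + (s i)\<^sup>2)"
    unfolding queue_step_apply by (intro sum_mono sq)
  moreover have "(\<Sum>i\<in>UNIV. ?b i * q i) = a * q (route r q)"
    by (simp add: arrivals_def if_distrib[of "\<lambda>x. x * _"] cong: if_cong)
  moreover have "(\<Sum>i\<in>UNIV. (?b i)\<^sup>2) = a\<^sup>2"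
    by (simp add: arrivals_def if_distrib[of "\<lambda>x. x\<^sup>2"] cong: if_cong)
  ultimately show ?thesis by (simp add: sum.distrib sum_distrib_left[symmetric])
qed

lemma nn_integral_pair_fst: "(\<integral>\<^sup>+z. g (fst z) \<partial>measure_pmf (pair_pmf p r)) = (\<integral>\<^sup>+x. g x \<partial>measure_pmf p)"
  for g :: "'a \<Rightarrow> ennreal"
  using nn_integral_map_pmf[of fst "pair_pmf p r" g] by (simp add: map_fst_pair_pmf)

lemma nn_integral_pair_snd: "(\<integral>\<^sup>+z. g (snd z) \<partial>measure_pmf (pair_pmf p r)) = (\<integral>\<^sup>+x. g x \<partial>measure_pmf r)"
  for g :: "'a \<Rightarrow> ennreal"
  using nn_integral_map_pmf[of snd "pair_pmf p r" g] by (simp add: map_snd_pair_pmf)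

lemma nn_integral_pair_mult:
  "(\<integral>\<^sup>+z. g (fst z) * h (snd z) \<partial>measure_pmf (pair_pmf p r)) =
    (\<integral>\<^sup>+x. g x \<partial>measure_pmf p) * (\<integral>\<^sup>+y. h y \<partial>measure_pmf r)" for g h :: "_ \<Rightarrow> ennreal"
  by (simp add: nn_integral_pair_pmf' nn_integral_cmult nn_integral_multc)

text \<open>Within a slot, arrivals and routing randomness are independent, so the cross term
  factors. The additive form in \<open>ennreal\<close> postpones questions of finiteness.\<close>

lemma expected_squares_drift:
  fixes A :: "nat pmf" and S :: "('n::finite \<Rightarrow> nat) pmf" and R :: "'r pmf"
  shows "(\<integral>\<^sup>+z. of_nat (\<Sum>i\<in>UNIV. (queue_step route q z i)\<^sup>2) \<partial>measure_pmf (pair_pmf A (pair_pmf S R))) +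
      2 * (\<Sum>i\<in>UNIV. of_nat (q i) * (\<integral>\<^sup>+s. of_nat (s i) \<partial>measure_pmf S)) \<le>
    of_nat (\<Sum>i\<in>UNIV. (q i)\<^sup>2) +
      2 * ((\<integral>\<^sup>+a. of_nat a \<partial>measure_pmf A) * (\<integral>\<^sup>+r. of_nat (q (route r q)) \<partial>measure_pmf R)) +
      ((\<integral>\<^sup>+a. of_nat (a\<^sup>2) \<partial>measure_pmf A) + (\<Sum>i\<in>UNIV. \<integral>\<^sup>+s. of_nat ((s i)\<^sup>2) \<partial>measure_pmf S))"
proof -
  let ?I = "measure_pmf (pair_pmf A (pair_pmf S R))"
  let ?V = "\<lambda>q. \<Sum>i\<in>UNIV. (q i)\<^sup>2"
  have services: "(\<integral>\<^sup>+z. g (fst (snd z)) \<partial>?I) = (\<integral>\<^sup>+s. g s \<partial>measure_pmf S)" for g :: "_ \<Rightarrow> ennreal"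
    by (simp add: nn_integral_pair_snd[where g = "\<lambda>y. g (fst y)"] nn_integral_pair_fst)
  have routed: "(\<integral>\<^sup>+z. of_nat (fst z) * of_nat (q (route (snd (snd z)) q)) \<partial>?I) =
      (\<integral>\<^sup>+a. of_nat a \<partial>measure_pmf A) * (\<integral>\<^sup>+r. of_nat (q (route r q)) \<partial>measure_pmf R)"
    using nn_integral_pair_mult[where g = of_nat and h = "\<lambda>y. of_nat (q (route (snd y) q))" and p = A and r = "pair_pmf S R"]
    by (simp add: nn_integral_pair_snd[where g = "\<lambda>r. of_nat (q (route r q))"])
  have "(\<integral>\<^sup>+z. of_nat (?V (queue_step route q z) + 2 * (\<Sum>i\<in>UNIV. q i * fst (snd z) i)) \<partial>?I) \<le>
      (\<integral>\<^sup>+z. of_nat (?V q + 2 * (fst z * q (route (snd (snd z)) q)) +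
        (fst z)\<^sup>2 + ?V (fst (snd z))) \<partial>?I)"
  proof (rule nn_integral_mono)
    fix z
    show "of_nat (?V (queue_step route q z) + 2 * (\<Sum>i\<in>UNIV. q i * fst (snd z) i)) \<le>
      (of_nat (?V q + 2 * (fst z * q (route (snd (snd z)) q)) + (fst z)\<^sup>2 + ?V (fst (snd z))) :: ennreal)"
      using queue_step_square[of route q "fst z" "fst (snd z)" "snd (snd z)"]
      by (simp only: prod.collapse of_nat_le_iff)
  qed
  also have "(\<integral>\<^sup>+z. of_nat (?V (queue_step route q z) + 2 * (\<Sum>i\<in>UNIV. q i * fst (snd z) i)) \<partial>?I) =
      (\<integral>\<^sup>+z. of_nat (?V (queue_step route q z)) \<partial>?I) +
      2 * (\<Sum>i\<in>UNIV. of_nat (q i) * (\<integral>\<^sup>+s. of_nat (s i) \<partial>measure_pmf S))"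
    by (simp add: nn_integral_add nn_integral_cmult nn_integral_sum services[of "\<lambda>s. of_nat (s _)"]
        del: of_nat_power)
  also have "(\<integral>\<^sup>+z. of_nat (?V q + 2 * (fst z * q (route (snd (snd z)) q)) +
        (fst z)\<^sup>2 + ?V (fst (snd z))) \<partial>?I) =
      of_nat (?V q) +
      2 * ((\<integral>\<^sup>+a. of_nat a \<partial>measure_pmf A) * (\<integral>\<^sup>+r. of_nat (q (route r q)) \<partial>measure_pmf R)) +
      ((\<integral>\<^sup>+a. of_nat (a\<^sup>2) \<partial>measure_pmf A) + (\<Sum>i\<in>UNIV. \<integral>\<^sup>+s. of_nat ((s i)\<^sup>2) \<partial>measure_pmf S))"
    by (simp add: nn_integral_add nn_integral_cmult nn_integral_sum routed add.assoc
        services[of "\<lambda>s. of_nat (s _ ^ 2)"] nn_integral_pair_fst[where g = "\<lambda>a. of_nat (a ^ 2)"]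
        measure_pmf.emeasure_space_1 del: of_nat_power)
  finally show ?thesis .
qed

section \<open>Sufficiency by quadratic drift\<close>

theorem power_of_d_stable:
  fixes A :: "nat pmf" and B :: "('n::finite \<Rightarrow> nat) pmf"
  assumes d: "1 \<le> d" "d \<le> CARD('n)"
    and B: "\<And>i. integrable (measure_pmf B) (\<lambda>s. (real (s i))\<^sup>2)"
    and A: "integrable (measure_pmf A) (\<lambda>a. (real a)\<^sup>2)"
    and pos: "\<And>i. 0 < mean_service B i"
    and less: "measure_pmf.expectation A real < sum (mean_service B) UNIV"
    and region: "mean_service B \<in> stability_region d"
  shows "positive_recurrent (input_space A B (power_of_d_randomness d)) (queue_process power_of_d_route)"
proof -
  let ?R = "power_of_d_randomness d :: ('n set \<times> ('n set \<Rightarrow> 'n)) pmf"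
  let ?I = "pair_pmf A (pair_pmf B ?R)"
  interpret random_recursion "queue_step power_of_d_route" ?I .
  define \<mu> where "\<mu> = mean_service B"
  define \<Sigma> where "\<Sigma> = sum \<mu> UNIV"
  define l where "l = measure_pmf.expectation A real"
  define C where "C = measure_pmf.expectation A (\<lambda>a. (real a)\<^sup>2) +
    (\<Sum>i\<in>UNIV. measure_pmf.expectation B (\<lambda>s. (real (s i))\<^sup>2))"
  \<comment> \<open>The net coefficient of \<open>Q\<close>: services contribute
    \<open>- 2 * Q q\<close>, arrivals at most \<open>2 * l * Q q / \<Sigma>\<close>.\<close>
  define \<epsilon> where "\<epsilon> = 2 * (1 - l / \<Sigma>)"
  define V where "V q = (\<Sum>i\<in>UNIV. (q i)\<^sup>2)" for q :: "'n \<Rightarrow> nat"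
  define Q where "Q q = (\<Sum>i\<in>UNIV. \<mu> i * q i)" for q :: "'n \<Rightarrow> nat"
  \<comment> \<open>Outside \<open>F\<close> the drift bound \<open>C - \<epsilon> * Q q\<close> is
    at most -1.\<close>
  define F where "F = {q. \<epsilon> * Q q < C + 1}"
  have \<mu>: "\<mu> i > 0" for i using pos by (simp add: \<mu>_def)
  then have \<Sigma>: "\<Sigma> > 0" unfolding \<Sigma>_def by (intro sum_pos) auto
  have l: "0 \<le> l" "l < \<Sigma>" using less by (auto simp: l_def \<Sigma>_def \<mu>_def)
  have \<epsilon>: "\<epsilon> > 0" using l \<Sigma> by (simp add: \<epsilon>_def field_simps)
  have C: "C \<ge> 0" unfolding C_def by (intro add_nonneg_nonneg sum_nonneg) auto
  have Q: "Q q \<ge> 0" for q unfolding Q_def using \<mu> by (intro sum_nonneg) (simp add: less_imp_le)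
  have mean_A: "(\<integral>\<^sup>+a. of_nat a \<partial>measure_pmf A) = ennreal l"
    unfolding l_def by (rule nn_integral_of_nat_pmf[OF integrable_of_nat_square[OF A]])
  have mean_S: "(\<integral>\<^sup>+s. of_nat (s i) \<partial>measure_pmf B) = ennreal (\<mu> i)" for i
    unfolding \<mu>_def mean_service_def by (rule nn_integral_of_nat_pmf[OF integrable_of_nat_square[OF B]])
  have sq: "(\<integral>\<^sup>+a. of_nat (a\<^sup>2) \<partial>measure_pmf A) + (\<Sum>i\<in>UNIV. \<integral>\<^sup>+s. of_nat ((s i)\<^sup>2) \<partial>measure_pmf B) = ennreal C"
  proof -
    have "(\<integral>\<^sup>+a. of_nat (a\<^sup>2) \<partial>measure_pmf A) = ennreal (measure_pmf.expectation A (\<lambda>a. (real a)\<^sup>2))"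
      using nn_integral_of_nat_pmf[of A "\<lambda>a. a\<^sup>2"] A by simp
    moreover have "(\<integral>\<^sup>+s. of_nat ((s i)\<^sup>2) \<partial>measure_pmf B) =
        ennreal (measure_pmf.expectation B (\<lambda>s. (real (s i))\<^sup>2))" for i
      using nn_integral_of_nat_pmf[of B "\<lambda>s. (s i)\<^sup>2"] B by simp
    ultimately show ?thesis by (simp add: C_def sum_nonneg flip: ennreal_plus)
  qed
  have drift: "1 + (\<integral>\<^sup>+z. of_nat (V (queue_step power_of_d_route q z)) \<partial>measure_pmf ?I) \<le>
      of_nat (V q) + ennreal (C + 1) * indicator F q" for q
  proof -
    let ?X = "\<integral>\<^sup>+z. of_nat (V (queue_step power_of_d_route q z)) \<partial>measure_pmf ?I"
    have route: "(\<integral>\<^sup>+r. of_nat (q (power_of_d_route r q)) \<partial>measure_pmf ?R) \<le> ennreal (Q q / \<Sigma>)"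
      unfolding Q_def \<Sigma>_def
      by (rule shortest_sampled_queue) (use d region \<Sigma> in \<open>auto simp: \<mu>_def \<Sigma>_def\<close>)
    have "?X + 2 * (\<Sum>i\<in>UNIV. of_nat (q i) * ennreal (\<mu> i)) \<le>
        of_nat (V q) + 2 * (ennreal l * (\<integral>\<^sup>+r. of_nat (q (power_of_d_route r q)) \<partial>measure_pmf ?R)) + ennreal C"
      using expected_squares_drift[where route = power_of_d_route and q = q and A = A and S = B and R = ?R]
      unfolding mean_A mean_S sq V_def .
    also have "\<dots> \<le> of_nat (V q) + 2 * (ennreal l * ennreal (Q q / \<Sigma>)) + ennreal C"
      by (intro add_mono mult_left_mono order_refl route) auto
    also have "\<dots> = ennreal (V q + 2 * (l * (Q q / \<Sigma>)) + C)"
      using l C Q[of q] \<Sigma>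
      by (simp add: ennreal_of_nat_eq_real_of_nat ennreal_mult ennreal_plus del: times_divide_eq_right)
    also have "2 * (\<Sum>i\<in>UNIV. of_nat (q i) * ennreal (\<mu> i)) = ennreal (2 * Q q)"
      using \<mu> by (simp add: Q_def ennreal_of_nat_eq_real_of_nat ennreal_mult'' less_imp_le mult.commute
          sum_nonneg flip: sum_ennreal)
    finally have *: "?X + ennreal (2 * Q q) \<le> ennreal (V q + 2 * (l * (Q q / \<Sigma>)) + C)" .
    \<comment> \<open>Finiteness allows the inequality to be moved to the reals, where the terms in
      \<open>Q\<close> can be subtracted.\<close>
    then have "?X < \<infinity>" by (auto simp: less_top[symmetric] top_unique)
    then obtain x where x: "?X = ennreal x" "0 \<le> x" by (cases ?X) auto
    have nonneg: "0 \<le> l * (Q q / \<Sigma>)" using l Q[of q] \<Sigma> by simp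
    have "x + 2 * Q q \<le> V q + 2 * (l * (Q q / \<Sigma>)) + C"
      using * x Q[of q] C nonneg by (simp flip: ennreal_plus)
    then have bound: "x + \<epsilon> * Q q \<le> V q + C"
      by (simp add: \<epsilon>_def algebra_simps)
    have "1 + ?X = ennreal (1 + x)" using x by (simp add: ennreal_plus)
    also have "\<dots> \<le> ennreal (V q + (C + 1) * indicator F q)"
    proof (rule ennreal_leI, cases "q \<in> F")
      case True
      have "0 \<le> \<epsilon> * Q q" using \<epsilon> Q[of q] by simp
      with bound True show "1 + x \<le> V q + (C + 1) * indicator F q" by simp
    next
      case False
      with bound show "1 + x \<le> V q + (C + 1) * indicator F q" by (simp add: F_def)
    qed
    also have "\<dots> = of_nat (V q) + ennreal (C + 1) * indicator F q"
      using C by (simp add: ennreal_of_nat_eq_real_of_nat ennreal_plus indicator_def)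
    finally show ?thesis .
  qed
  have "finite F"
    using finite_weighted_sublevel[of "\<lambda>i. \<epsilon> * \<mu> i" "C + 1"] \<epsilon> \<mu>
    by (simp add: F_def Q_def sum_distrib_left mult.assoc)
  then have "positive_recurrent (\<Pi>\<^sub>M k\<in>UNIV. measure_pmf ?I) orbit"
    by (intro foster_positive_recurrent[OF drift]) (auto simp: ennreal_of_nat_eq_real_of_nat)
  then show ?thesis by (simp add: input_space_def queue_process_orbit)
qed

section \<open>Necessity by balance over a cycle\<close>

theorem power_of_d_necessary:
  fixes A :: "nat pmf" and B :: "('n::finite \<Rightarrow> nat) pmf" and J :: "'n set"
  assumes d: "1 \<le> d" "d \<le> CARD('n)"
    and B: "\<And>i. integrable (measure_pmf B) (\<lambda>s. (real (s i))\<^sup>2)"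
    and A: "integrable (measure_pmf A) (\<lambda>a. (real a)\<^sup>2)"
    and rec: "positive_recurrent (input_space A B (power_of_d_randomness d)) (queue_process power_of_d_route)"
  shows "measure_pmf.expectation A real * (real (card J choose d) / real (CARD('n) choose d)) \<le>
    sum (mean_service B) J"
proof -
  let ?R = "power_of_d_randomness d :: ('n set \<times> ('n set \<Rightarrow> 'n)) pmf"
  let ?I = "pair_pmf A (pair_pmf B ?R)"
  interpret random_recursion "queue_step power_of_d_route" ?I .
  \<comment> \<open>The balance lemma requires functions of the slot input alone: \<alpha> counts
    the arrivals forced into \<open>J\<close> whatever the queue lengths, and \<beta> the potential
    services in \<open>J\<close>, which bound the departures.\<close>
  define \<alpha> where "\<alpha> z = (case z of (a, s, r) \<Rightarrow> if fst r \<subseteq> J then a else 0)"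
    for z :: "('n, 'n set \<times> ('n set \<Rightarrow> 'n)) slot_input"
  define \<beta> where "\<beta> z = (\<Sum>i\<in>J. fst (snd z) i)"
    for z :: "('n, 'n set \<times> ('n set \<Rightarrow> 'n)) slot_input"
  have "positive_recurrent S orbit"
    using rec by (simp add: input_space_def queue_process_orbit)
  \<comment> \<open>The path from the empty system serves to exhibit one positive recurrent
    state.\<close>
  then have "AE \<omega> in S. \<exists>k. positive_recurrent_state S orbit (orbit (\<lambda>_. 0) k \<omega>)"
    unfolding positive_recurrent_def ..
  from eventually_happens'[OF ae_filter_bot this]
  obtain q where q: "positive_recurrent_state S orbit q" by blast
  have "(\<integral>\<^sup>+z. of_nat (\<alpha> z) \<partial>measure_pmf ?I) \<le> (\<integral>\<^sup>+z. of_nat (\<beta> z) \<partial>measure_pmf ?I)"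
  proof (rule positive_recurrent_balance[OF _ q])
    fix q :: "'n \<Rightarrow> nat" and z assume "z \<in> set_pmf ?I"
    obtain a s r where z: "z = (a, s, r)" by (cases z)
    with \<open>z \<in> set_pmf ?I\<close> have "r \<in> set_pmf ?R" by simp
    then have "power_of_d_route r q \<in> fst r"
      using set_pmf_power_of_d_randomness[OF _ d] by (auto simp: shortest_def)
    then have "\<alpha> z \<le> (\<Sum>i\<in>J. arrivals a (power_of_d_route r q) i)"
      by (auto simp: sum_arrivals \<alpha>_def z)
    then have "(\<Sum>i\<in>J. q i) + \<alpha> z \<le> (\<Sum>i\<in>J. q i + arrivals a (power_of_d_route r q) i)"
      by (simp add: sum.distrib)
    also have "\<dots> \<le> (\<Sum>i\<in>J. queue_step power_of_d_route q z i + s i)"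
      unfolding z queue_step_apply by (intro sum_mono) simp
    finally show "(\<Sum>i\<in>J. q i) + \<alpha> z \<le> (\<Sum>i\<in>J. queue_step power_of_d_route q z i) + \<beta> z"
      by (simp add: sum.distrib \<beta>_def z)
  qed
  also have "(\<integral>\<^sup>+z. of_nat (\<alpha> z) \<partial>measure_pmf ?I) =
      (\<integral>\<^sup>+a. of_nat a \<partial>measure_pmf A) * (\<integral>\<^sup>+r. indicator {r. fst r \<subseteq> J} r \<partial>measure_pmf ?R)"
  proof -
    have "(\<integral>\<^sup>+z. of_nat (\<alpha> z) \<partial>measure_pmf ?I) =
        (\<integral>\<^sup>+z. of_nat (fst z) * indicator {r. fst r \<subseteq> J} (snd (snd z)) \<partial>measure_pmf ?I)"
      by (intro nn_integral_cong) (auto simp: \<alpha>_def)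
    then show ?thesis
      by (simp only: nn_integral_pair_mult[where g = of_nat and h = "\<lambda>y. indicator {r. fst r \<subseteq> J} (snd y)"]
          nn_integral_pair_snd[where g = "indicator {r. fst r \<subseteq> J}"])
  qed
  also have "(\<integral>\<^sup>+z. of_nat (\<beta> z) \<partial>measure_pmf ?I) = (\<Sum>i\<in>J. \<integral>\<^sup>+s. of_nat (s i) \<partial>measure_pmf B)"
  proof -
    have "(\<integral>\<^sup>+z. of_nat (fst (snd z) i) \<partial>measure_pmf ?I) = (\<integral>\<^sup>+s. of_nat (s i) \<partial>measure_pmf B)" for i
      by (simp add: nn_integral_pair_snd[where g = "\<lambda>y. of_nat (fst y i)"] nn_integral_pair_fst[where g = "\<lambda>s. of_nat (s i)"])
    then show ?thesis by (simp add: \<beta>_def nn_integral_sum)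
  qed
  also have "\<dots> = (\<Sum>i\<in>J. ennreal (mean_service B i))"
    unfolding mean_service_def
    by (intro sum.cong nn_integral_of_nat_pmf integrable_of_nat_square B refl)
  also have "\<dots> = ennreal (sum (mean_service B) J)"
    by (simp add: mean_service_def)
  finally have "ennreal (measure_pmf.expectation A real * (real (card J choose d) / real (CARD('n) choose d)))
      \<le> ennreal (sum (mean_service B) J)"
    unfolding prob_sample_subset[OF d(2)] nn_integral_of_nat_pmf[OF integrable_of_nat_square[OF A]]
    by (simp add: ennreal_mult'' del: times_divide_eq_right)
  then show ?thesis
    by (subst (asm) ennreal_le_iff) (auto simp: mean_service_def intro!: sum_nonneg)
qed

text \<open>For \<open>2 \<le> d\<close> the equivalence is stated for positive means, because the
  region then also contains vectors with a zero entry, and an unserved queue can grow without bound.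
  For \<open>d = 1\<close> positivity follows from membership in the region.\<close>

theorem theorem1:
  fixes d :: nat
    and A :: "real \<Rightarrow> nat pmf"
    and S :: "('n::finite \<Rightarrow> nat) pmf"
    and \<mu> :: "'n \<Rightarrow> real"
  assumes "1 \<le> d" and "d \<le> CARD('n) - 1"
    and "\<And>i. integrable (measure_pmf S) (\<lambda>s. (real (s i))\<^sup>2)"
    and "\<mu> = mean_service S"
    and "(\<Sum>i\<in>UNIV. \<mu> i) > 0"
    and "\<And>l. l \<in> interior (capacity_region \<mu>) \<Longrightarrow>
           integrable (measure_pmf (A l)) (\<lambda>a. (real a)\<^sup>2)"
    and "\<And>l. l \<in> interior (capacity_region \<mu>) \<Longrightarrow>
           measure_pmf.expectation (A l) real = l"
  shows "(throughput_optimal A S (power_of_d_randomness d) power_of_d_route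
            \<longrightarrow> \<mu> \<in> stability_region d) \<and>
         ((2 \<le> d \<longrightarrow> (\<forall>i. 0 < \<mu> i)) \<longrightarrow>
           (throughput_optimal A S (power_of_d_randomness d) power_of_d_route
              \<longleftrightarrow> \<mu> \<in> stability_region d))"
proof -
  have d: "1 \<le> d" "d \<le> CARD('n)" using assms(1,2) by auto
  have int: "interior (capacity_region \<mu>) = {0 <..< sum \<mu> UNIV}"
    by (rule interior_capacity_region)
  have nonneg: "0 \<le> \<mu> i" for i by (simp add: assms(4) mean_service_def)
  have necessity: "\<mu> \<in> stability_region d"
    if opt: "throughput_optimal A S (power_of_d_randomness d) power_of_d_route"
  proof -
    have "real (j choose d) / real (CARD('n) choose d) \<le> (\<Sum>i=1..j. order_stat \<mu> i) / sum \<mu> UNIV"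
      if j: "j \<le> CARD('n) - 1" for j
    proof -
      obtain J :: "'n set" where J: "card J = j" "sum \<mu> J = (\<Sum>i=1..j. order_stat \<mu> i)"
        using sum_order_stat_attained[of j \<mu>] j by (meson diff_le_self le_trans)
      define p where "p = real (j choose d) / real (CARD('n) choose d)"
      have "p \<ge> 0" by (simp add: p_def)
      have le: "l * p \<le> sum \<mu> J" if l: "0 < l" "l < sum \<mu> UNIV" for l
        using power_of_d_necessary[OF d assms(3), of "A l" J] opt l assms(6,7)[of l]
        unfolding throughput_optimal_def int assms(4)[symmetric] p_def J(1)
        by auto
      have "sum \<mu> UNIV * p \<le> sum \<mu> J"
      proof (rule ccontr)
        assume "\<not> sum \<mu> UNIV * p \<le> sum \<mu> J"
        then have less: "sum \<mu> J < sum \<mu> UNIV * p" by simp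
        with nonneg \<open>p \<ge> 0\<close> assms(5) have p: "p > 0"
          by (metis less_eq_real_def mult_zero_right not_less sum_nonneg)
        \<comment> \<open>A violated inequality leaves room for an admissible rate \<open>l\<close>
          with \<open>l * p > sum \<mu> J\<close>; the maximum with 0 keeps \<open>l\<close> in the
          interior of the capacity region.\<close>
        have "max 0 (sum \<mu> J / p) < sum \<mu> UNIV"
          using less p assms(5) by (simp add: field_simps)
        then obtain l where "max 0 (sum \<mu> J / p) < l" "l < sum \<mu> UNIV" using dense by blast
        then show False using le[of l] p by (simp add: field_simps)
      qed
      then show ?thesis
        using assms(5) unfolding J(2) p_def[symmetric] by (simp add: field_simps)
    qed
    with nonneg show ?thesis by (auto simp: stability_region_def)
  qed
  moreover have "throughput_optimal A S (power_of_d_randomness d) power_of_d_route"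
    if region: "\<mu> \<in> stability_region d" and pos2: "2 \<le> d \<longrightarrow> (\<forall>i. 0 < \<mu> i)"
  proof -
    have pos: "0 < \<mu> i" for i
    proof (cases "2 \<le> d")
      case False
      with d have [simp]: "d = 1" by simp
      \<comment> \<open>For \<open>d = 1\<close> the subset inequality for a singleton says that
        each mean is at least the average of all means.\<close>
      have "0 < sum \<mu> UNIV * (real (card {i} choose d) / real (CARD('n) choose d))"
        using assms(5) by (simp add: zero_less_card_finite)
      also have "\<dots> \<le> sum \<mu> {i}"
        by (rule stability_region_subset_sum[OF region d(2) assms(5)])
      finally show ?thesis by simp
    qed (use pos2 in simp)
    show ?thesis
      unfolding throughput_optimal_def assms(4)[symmetric] int
    proof
      fix l assume "l \<in> {0 <..< sum \<mu> UNIV}"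
      with assms(6,7)[of l] int
      have "integrable (measure_pmf (A l)) (\<lambda>a. (real a)\<^sup>2)" "measure_pmf.expectation (A l) real < sum \<mu> UNIV"
        by auto
      then show "positive_recurrent (input_space (A l) S (power_of_d_randomness d)) (queue_process power_of_d_route)"
        using power_of_d_stable[OF d assms(3)] pos region by (simp add: assms(4)[symmetric])
    qed
  qed
  ultimately show ?thesis by blast
qed

end
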